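(* The module of obstructions $\mathbb{O}_{\mathcal{P}erm}$ of the operad $\mathcal{P}erm$ satisfies $\mathrm{H}_1(\mathbb{O}_{\mathcal{P}erm})\neq0$.
   Context: $\mathbb{K}$ is a field of characteristic $0$; everything is differential graded (homological grading). $\mathbb{S}$-modules are families of dg $\mathbb{K}[\mathbb{S}_n]$-modules, $n\ge0$; $\circ$ is the usual composition product with unit $I$; $M\circ(N,N')$ is the part of $M\circ(N\oplus N')$ linear in $N'$; $M\circ_{(1)}N:=M\circ(I,N)$; $f\circ' g=\sum_j f\otimes(id\otimes\cdots\otimes g\otimes\cdots\otimes id)$ ($g$ in position $j$). Operads $(\mathcal{P},\gamma)$ and cooperads $(\mathcal{C},\Delta)$ are monoids/comonoids for $\circ$; $\gamma_p$, $\Delta_p:\mathcal{C}\to\mathcal{C}\circ_{(1)}\mathcal{C}$ are the partial (co)products. $\mathcal{P}erm$ is the operad with $\mathcal{P}erm(0)=0$ and, for $n\ge1$, $\mathcal{P}erm(n)=\mathbb{K}^n$ with basis $e^n_1,\dots,e^n_n$ ($e^n_i$ is the corolla with $n$ labelled leaves and leaf $i$ underlined; $\mathbb{S}_n$ permutes the labels) in degree $0$, and composition $\gamma(e^k_i;e^{n_1}_{j_1},\dots,e^{n_k}_{j_k})=e^{n_1+\cdots+n_k}_{n_1+\cdots+n_{i-1}+j_i}$. For an augmented operad $\mathcal{P}$ and a coaugmented cooperad $\mathcal{C}$, an operadic twisting morphism is a degree $-1$ map $\alpha:\mathcal{C}\to\mathcal{P}$ with $\partial(\alpha)+\gamma_p(\alpha\circ_{(1)}\alpha)\Delta_p=0$;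 it is a Koszul morphism if $\mathcal{P}\circ_\alpha\mathcal{C}\to I$ is a quasi-isomorphism, where $\mathcal{P}\circ_\alpha\mathcal{C}$ is $\mathcal{P}\circ\mathcal{C}$ with differential $d_{\mathcal{P}\circ\mathcal{C}}-\delta^l_\alpha$ and $\delta^l_\alpha$ applies $\Delta$ to one factor $\mathcal{C}$ at a time (via $id\circ'\Delta$), then $\alpha$ to the resulting lower factor, then $\gamma$. For $\mathcal{P}=\mathcal{P}erm$ one may take the bar construction $\mathcal{C}=\mathcal{B}(\mathcal{P}erm)=\mathcal{F}^c(s\overline{\mathcal{P}erm})$ with $\pi:\mathcal{B}(\mathcal{P}erm)\to s\overline{\mathcal{P}erm}\to\overline{\mathcal{P}erm}\to\mathcal{P}erm$, or the Koszul dual cooperad $\mathcal{P}erm^{\text{!`}}\subset\mathcal{B}(\mathcal{P}erm)$ with the restriction $\kappa$ of $\pi$. Given a Koszul morphism $\alpha:\mathcal{C}\to\mathcal{P}$: $L_{\mathcal{P}}:=\mathcal{P}\circ_{(1)}(\mathcal{C}\circ\mathcal{P})$ with differential $d_{\mathcal{P}\circ_{(1)}(\mathcal{C}\circ\mathcal{P})}-\delta^l+\delta^r$, where $\delta^l$ applies $\Delta_p$ to $\mathcal{C}$, then $\alpha$ to the factor nearest the root, and composes the result in $\mathcal{P}$ with the root factor $\mathcal{P}$ and with the upper factors $\mathcal{P}$ not attached to the remaining factor $\mathcal{C}$; $\delta^r$ applies $\Delta_p$ to $\mathcal{C}$, then $\alpha$ to the upper factor, and composes it with the upper factors $\mathcal{P}$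 above it. $\Omega_{\mathcal{P}}$ is the coequalizer, in infinitesimal $\mathcal{P}$-bimodules, of $id\circ_{(1)}\gamma$ and $c_2:\mathcal{P}\circ_{(1)}(\mathcal{P}\circ\mathcal{P})\rightrightarrows\mathcal{P}\circ_{(1)}\mathcal{P}$, where $c_2$ is $\mathcal{P}\circ_{(1)}(\mathcal{P}\circ\mathcal{P})\xrightarrow{id\circ_{(1)}(id\circ' id)}\mathcal{P}\circ_{(1)}(\mathcal{P}\circ(\mathcal{P},\mathcal{P}))\to(\mathcal{P}\circ\mathcal{P}\circ\mathcal{P})\circ_{(1)}\mathcal{P}\xrightarrow{\gamma\circ\gamma\circ_{(1)}id}\mathcal{P}\circ_{(1)}\mathcal{P}$. Both are right $\mathcal{P}$-modules. With $I$ a left $\mathcal{P}$-module via the augmentation and $\circ_{\mathcal{P}}$ the relative composition product, put $\overline{L}_{\mathcal{P}}:=L_{\mathcal{P}}\circ_{\mathcal{P}}I$ and $\overline{\Omega}_{\mathcal{P}}:=\Omega_{\mathcal{P}}\circ_{\mathcal{P}}I$. The counit $\mathcal{C}\to I$ induces surjections $L_{\mathcal{P}}\to\mathcal{P}\circ_{(1)}\mathcal{P}\to\Omega_{\mathcal{P}}$ and $\overline{L}_{\mathcal{P}}\to\overline{\Omega}_{\mathcal{P}}$. The module of obstructions $\mathbb{O}_{\mathcal{P}}$ is the class, in the homotopy category of infinitesimal left $\mathcal{P}$-modules (independent of $\alpha$), of the dg $\mathbb{S}$-module $O_{\mathcal{P}}:=\ker(\overline{L}_{\mathcal{P}}\to\overline{\Omega}_{\mathcal{P}})$,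 and $\mathrm{H}_\bullet(\mathbb{O}_{\mathcal{P}})=\mathrm{H}_\bullet(O_{\mathcal{P}})$. *)

theory Defs
  imports
    Complex_Main
    "HOL-Library.Poly_Mapping"
    "HOL-Combinatorics.Permutations"
begin

section \<open>Free vector spaces\<close>

text \<open>
  The type \<open>'x \<Rightarrow>\<^sub>0 'k\<close> of finitely supported functions is the \<open>'k\<close>-vector space with basis \<open>'x\<close>.
\<close>

definition scl :: "'k \<Rightarrow> ('x \<Rightarrow>\<^sub>0 'k) \<Rightarrow> ('x \<Rightarrow>\<^sub>0 'k::field)"
  where "scl c v = Poly_Mapping.map ((*) c) v"

lemma lookup_scl: "Poly_Mapping.lookup (scl c v) x = c * Poly_Mapping.lookup v x"
  by (simp add: scl_def Poly_Mapping.map.rep_eq when_def)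

global_interpretation vec: vector_space "scl :: 'k \<Rightarrow> ('x \<Rightarrow>\<^sub>0 'k) \<Rightarrow> ('x \<Rightarrow>\<^sub>0 'k::field)"
  by unfold_locales
    (auto intro!: poly_mapping_eqI simp: lookup_scl lookup_add algebra_simps)

definition bv :: "'x \<Rightarrow> ('x \<Rightarrow>\<^sub>0 'k::field)"
  where "bv x = Poly_Mapping.single x 1"

definition lin :: "('x \<Rightarrow> ('y \<Rightarrow>\<^sub>0 'k)) \<Rightarrow> ('x \<Rightarrow>\<^sub>0 'k) \<Rightarrow> ('y \<Rightarrow>\<^sub>0 'k::field)"
  where "lin f v = (\<Sum>x\<in>Poly_Mapping.keys v. scl (Poly_Mapping.lookup v x) (f x))"

text \<open>\<open>v\<^sub>1 \<otimes> \<dots> \<otimes> v\<^sub>k\<close>, expanded in the basis of lists of basis vectors.\<close>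

fun tens :: "('x \<Rightarrow>\<^sub>0 'k) list \<Rightarrow> ('x list \<Rightarrow>\<^sub>0 'k::field)" where
  "tens [] = bv []"
| "tens (v # vs) = lin (\<lambda>x. lin (\<lambda>xs. bv (x # xs)) (tens vs)) v"

definition ksgn :: "int \<Rightarrow> 'k::field"
  where "ksgn d = (if even d then 1 else - 1)"

text \<open>
  The Koszul sign of rearranging \<open>x\<^sub>0 \<otimes> \<dots> \<otimes> x\<^sub>k\<^sub>-\<^sub>1\<close>, with degrees \<open>ds\<close>, into
  \<open>x\<^bsub>s 0\<^esub> \<otimes> \<dots> \<otimes> x\<^bsub>s (k-1)\<^esub>\<close>.
\<close>

definition perm_sgn :: "int list \<Rightarrow> (nat \<Rightarrow> nat) \<Rightarrow> 'k::field"
  where "perm_sgn ds s =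
    (\<Prod>(i, j)\<in>{(i, j). i < j \<and> j < length ds \<and> s j < s i}. ksgn (ds ! s i * ds ! s j))"


section \<open>Differential graded S-modules\<close>

text \<open>
  A dg S-module is given by a presentation by homogeneous generators: it is the quotient of the
  vector space with basis \<open>gens\<close> by the subspace \<open>rels\<close>.  (Every dg S-module arises in this way,
  for instance with all its homogeneous elements as generators.)  \<open>act s x\<close> is the left action,
  relabelling the input \<open>i\<close> of \<open>x\<close> by \<open>s i\<close>; inputs are numbered from 0, and only permutations \<open>s\<close>
  of \<open>{..<ar x}\<close> matter.  Linear maps out of such a module are given on generators and extended
  by \<open>lin\<close>.
\<close>

record (overloaded) ('x, 'k) dgs =
  gens :: "'x set"
  ar :: "'x \<Rightarrow> nat"
  deg :: "'x \<Rightarrow> int"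
  rels :: "('x \<Rightarrow>\<^sub>0 'k) set"
  act :: "(nat \<Rightarrow> nat) \<Rightarrow> 'x \<Rightarrow> ('x \<Rightarrow>\<^sub>0 'k)"
  bd :: "'x \<Rightarrow> ('x \<Rightarrow>\<^sub>0 'k)"

definition hcomp :: "('x, 'k::field, 'z) dgs_scheme \<Rightarrow> nat \<Rightarrow> int \<Rightarrow> ('x \<Rightarrow>\<^sub>0 'k) set"
  where "hcomp M n d = {v. Poly_Mapping.keys v \<subseteq> {x \<in> gens M. ar M x = n \<and> deg M x = d}}"

definition unit_dgs :: "(unit, 'k::field) dgs"
  where "unit_dgs = \<lparr>gens = UNIV, ar = (\<lambda>_. 1), deg = (\<lambda>_. 0), rels = {0},
    act = (\<lambda>_ x. bv x), bd = (\<lambda>_. 0)\<rparr>"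

definition dsum :: "('x, 'k::field, 'z) dgs_scheme \<Rightarrow> ('y, 'k, 'w) dgs_scheme \<Rightarrow> ('x + 'y, 'k) dgs"
  where "dsum M N = \<lparr>
    gens = Inl ` gens M \<union> Inr ` gens N,
    ar = case_sum (ar M) (ar N),
    deg = case_sum (deg M) (deg N),
    rels = vec.span (lin (\<lambda>x. bv (Inl x)) ` rels M \<union> lin (\<lambda>y. bv (Inr y)) ` rels N),
    act = (\<lambda>s. case_sum (\<lambda>x. lin (\<lambda>x. bv (Inl x)) (act M s x)) (\<lambda>y. lin (\<lambda>y. bv (Inr y)) (act N s y))),
    bd = case_sum (\<lambda>x. lin (\<lambda>x. bv (Inl x)) (bd M x)) (\<lambda>y. lin (\<lambda>y. bv (Inr y)) (bd N y))\<rparr>"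


subsection \<open>The composition product\<close>

text \<open>
  A generator \<open>(m, [(x\<^sub>0, l\<^sub>0), \<dots>, (x\<^sub>k\<^sub>-\<^sub>1, l\<^sub>k\<^sub>-\<^sub>1)])\<close> of \<open>M \<circ> N\<close> is the two-level tree with root \<open>m\<close> and
  \<open>x\<^sub>i\<close> grafted on the input \<open>i\<close> of \<open>m\<close>, whose leaf number \<open>a\<close> of \<open>x\<^sub>i\<close> carries the label \<open>l\<^sub>i ! a\<close>;
  all labels together are \<open>0, \<dots>, n - 1\<close>, each once.  In the first two families of relations the
  membership conditions force \<open>r\<close> to be homogeneous in the arity.  The last two families of relations express
  the induction from \<open>S\<^bsub>i\<^sub>1\<^esub> \<times> \<dots> \<times> S\<^bsub>i\<^sub>k\<^esub>\<close> to \<open>S\<^sub>n\<close> and the coinvariants under \<open>S\<^sub>k\<close>.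
\<close>

definition compos_gens ::
    "('m, 'k::field, 'z) dgs_scheme \<Rightarrow> ('n, 'k, 'w) dgs_scheme \<Rightarrow> ('m \<times> ('n \<times> nat list) list) set"
  where "compos_gens M N = {(m, ns).
    m \<in> gens M \<and> length ns = ar M m \<and> (\<forall>(x, l)\<in>set ns. x \<in> gens N \<and> length l = ar N x) \<and>
    (let w = concat (map snd ns) in distinct w \<and> set w = {..<length w})}"

definition compos_rels ::
    "('m, 'k::field, 'z) dgs_scheme \<Rightarrow> ('n, 'k, 'w) dgs_scheme \<Rightarrow>
      (('m \<times> ('n \<times> nat list) list) \<Rightarrow>\<^sub>0 'k) set"
  where "compos_rels M N = vec.span (
    {lin (\<lambda>m. bv (m, ns)) r |r ns.
      r \<in> rels M \<and> (\<forall>m\<in>Poly_Mapping.keys r. (m, ns) \<in> compos_gens M N)} \<union>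
    {lin (\<lambda>x. bv (m, ns[j := (x, l)])) r |r m ns j l.
      r \<in> rels N \<and> j < length ns \<and>
      (\<forall>x\<in>Poly_Mapping.keys r. (m, ns[j := (x, l)]) \<in> compos_gens M N)} \<union>
    {lin (\<lambda>y. bv (m, ns[j := (y, l)])) (act N s x)
        - bv (m, ns[j := (x, map (\<lambda>a. l ! s a) [0..<ar N x])]) |m ns j x l s.
      (m, ns) \<in> compos_gens M N \<and> j < length ns \<and> ns ! j = (x, l) \<and> s permutes {..<ar N x}} \<union>
    {lin (\<lambda>m'. bv (m', ns)) (act M s m)
        - scl (perm_sgn (map (\<lambda>(x, l). deg N x) ns) s) (bv (m, map (\<lambda>i. ns ! s i) [0..<ar M m])) |m ns s.
      (m, ns) \<in> compos_gens M N \<and> s permutes {..<ar M m}})"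

definition compos ::
    "('m, 'k::field, 'z) dgs_scheme \<Rightarrow> ('n, 'k, 'w) dgs_scheme \<Rightarrow> ('m \<times> ('n \<times> nat list) list, 'k) dgs"
  where "compos M N = \<lparr>
    gens = compos_gens M N,
    ar = (\<lambda>(m, ns). length (concat (map snd ns))),
    deg = (\<lambda>(m, ns). deg M m + (\<Sum>(x, l)\<leftarrow>ns. deg N x)),
    rels = compos_rels M N,
    act = (\<lambda>s (m, ns). bv (m, map (\<lambda>(x, l). (x, map s l)) ns)),
    bd = (\<lambda>(m, ns). lin (\<lambda>m'. bv (m', ns)) (bd M m) +
      (\<Sum>j<length ns. scl (ksgn (deg M m + (\<Sum>(x, l)\<leftarrow>take j ns. deg N x)))
        (lin (\<lambda>y. bv (m, ns[j := (y, snd (ns ! j))])) (bd N (fst (ns ! j))))))\<rparr>"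

text \<open>
  \<open>M \<circ> (N, N')\<close>.  The relations of \<open>M \<circ> (N \<oplus> N')\<close> are homogeneous in the number of factors \<open>N'\<close>,
  so that cutting them down to the generators with exactly one such factor is the linear part.
\<close>

definition compos_lin ::
    "('m, 'k::field, 'z) dgs_scheme \<Rightarrow> ('n, 'k, 'w) dgs_scheme \<Rightarrow> ('p, 'k, 'u) dgs_scheme \<Rightarrow>
      ('m \<times> (('n + 'p) \<times> nat list) list, 'k) dgs"
  where "compos_lin M N N' = (let K = compos M (dsum N N');
      G = {(m, ns) \<in> gens K. length (filter (\<lambda>(x, l). \<not> isl x) ns) = 1}
    in K\<lparr>gens := G, rels := {r \<in> rels K. Poly_Mapping.keys r \<subseteq> G}\<rparr>)"

definition compos1 ::
    "('m, 'k::field, 'z) dgs_scheme \<Rightarrow> ('n, 'k, 'w) dgs_scheme \<Rightarrow>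
      ('m \<times> ((unit + 'n) \<times> nat list) list, 'k) dgs"
  where "compos1 M N = compos_lin M unit_dgs N"


section \<open>Operads and cooperads\<close>

text \<open>
  Operads are taken in degree 0 with zero differential, like \<open>Perm\<close>, so that operad elements
  create no Koszul signs.  \<open>gam p [q\<^sub>0, \<dots>, q\<^sub>k\<^sub>-\<^sub>1]\<close> is \<open>\<gamma>(p; q\<^sub>0, \<dots>, q\<^sub>k\<^sub>-\<^sub>1)\<close> with inputs numbered
  consecutively.  Operads are augmented, and the presentation is adapted to the splitting of \<open>P\<close>
  into \<open>I\<close> and the augmentation ideal: the generator \<open>one\<close> spans \<open>I\<close>, and the other generators
  generate the augmentation ideal.
\<close>

record (overloaded) ('x, 'k) operad = "('x, 'k) dgs" +
  gam :: "'x \<Rightarrow> 'x list \<Rightarrow> ('x \<Rightarrow>\<^sub>0 'k)"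
  one :: 'x

definition aug :: "('x, 'k::field, 'z) operad_scheme \<Rightarrow> 'x \<Rightarrow> 'k"
  where "aug P x = (if x = one P then 1 else 0)"

record (overloaded) ('x, 'k) cooperad = "('x, 'k) dgs" +
  cop :: "'x \<Rightarrow> (('x \<times> ('x \<times> nat list) list) \<Rightarrow>\<^sub>0 'k)"
  cou :: "'x \<Rightarrow> 'k"

text \<open>The infinitesimal decomposition \<open>\<Delta>\<^sub>p : C \<rightarrow> C \<circ>\<^sub>(\<^sub>1\<^sub>) C\<close>: \<open>id \<circ>' id\<close> after \<open>\<Delta>\<close>, followed by the
  counit on the upper factors that are not distinguished.\<close>

definition pcop :: "('x, 'k::field, 'z) cooperad_scheme \<Rightarrow> 'x \<Rightarrow>
      (('x \<times> ((unit + 'x) \<times> nat list) list) \<Rightarrow>\<^sub>0 'k)"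
  where "pcop C c = lin (\<lambda>(c', ns). \<Sum>j<length ns.
      scl (\<Prod>i\<in>{..<length ns} - {j}. cou C (fst (ns ! i)))
        (bv (c', map (\<lambda>i. (if i = j then Inr (fst (ns ! i)) else Inl (), snd (ns ! i)))
          [0..<length ns])))
    (cop C c)"

text \<open>
  If operations \<open>x\<^sub>0, x\<^sub>1, \<dots>\<close> with numbers of inputs given by \<open>a\<close> stand side by side and their inputs
  are numbered consecutively, then \<open>block a [x\<^sub>0, x\<^sub>1, \<dots>] i\<close> are the numbers of the inputs of \<open>x\<^sub>i\<close>.
\<close>

definition block :: "('x \<Rightarrow> nat) \<Rightarrow> 'x list \<Rightarrow> nat \<Rightarrow> nat list"
  where "block a xs i = (let s = (\<Sum>x\<leftarrow>take i xs. a x) in [s..<s + a (xs ! i)])"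

definition consec :: "('x \<Rightarrow> nat) \<Rightarrow> 'x list \<Rightarrow> ('x \<times> nat list) list"
  where "consec a xs = map (\<lambda>i. (xs ! i, block a xs i)) [0..<length xs]"

text \<open>
  Let \<open>qs\<close> be the upper level of a generator \<open>(c, qs)\<close> whose leaf number \<open>i\<close> carries the label
  \<open>l ! i\<close>.  \<open>unfold_labels\<close> writes these labels directly on the leaves of the \<open>qs\<close>; \<open>fold_labels\<close>
  goes back, to a generator with consecutively numbered leaves and its list of labels.
\<close>

definition unfold_labels :: "('q \<times> nat list) list \<Rightarrow> nat list \<Rightarrow> ('q \<times> nat list) list"
  where "unfold_labels qs l = map (\<lambda>(q, l'). (q, map ((!) l) l')) qs"

definition fold_labels ::
    "('q \<Rightarrow> nat) \<Rightarrow> 'c \<Rightarrow> ('q \<times> nat list) list \<Rightarrow> ('c \<times> ('q \<times> nat list) list) \<times> nat list"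
  where "fold_labels a c qs = ((c, consec a (map fst qs)), concat (map snd qs))"

text \<open>Composition in \<open>P\<close>, where each upper operation comes with the list of what sits on its inputs.\<close>

definition graft :: "('p, 'k::field, 'z) operad_scheme \<Rightarrow> 'p \<Rightarrow> ('p \<times> 's list) list \<Rightarrow>
      (('p \<times> 's list) \<Rightarrow>\<^sub>0 'k)"
  where "graft P p es = lin (\<lambda>q. bv (q, concat (map snd es))) (gam P p (map fst es))"

text \<open>Composition of \<open>x\<close>, with contents \<open>S\<close> on its inputs, with \<open>p\<close> at the input \<open>v\<close>.\<close>

definition graft_at :: "('p, 'k::field, 'z) operad_scheme \<Rightarrow> 'p \<Rightarrow> 's list \<Rightarrow> nat \<Rightarrow>
      ('p \<times> 's list) \<Rightarrow> (('p \<times> 's list) \<Rightarrow>\<^sub>0 'k)"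
  where "graft_at P p slots v e =
    graft P p (map (\<lambda>i. if i = v then e else (one P, [slots ! i])) [0..<length slots])"

definition leaves_of :: "nat list \<Rightarrow> ((unit + 'n) \<times> nat list) list"
  where "leaves_of l = map (\<lambda>b. (Inl (), [b])) l"


subsection \<open>Right modules and the relative composition product\<close>

text \<open>
  A right action of \<open>P\<close> on \<open>M\<close> is a map \<open>\<rho>\<close>, where \<open>\<rho> m [r\<^sub>0, \<dots>, r\<^sub>n\<^sub>-\<^sub>1]\<close> has \<open>r\<^sub>i\<close> on the input
  \<open>i\<close> of \<open>m\<close> and inputs numbered consecutively.
\<close>

definition ract_compos :: "('p, 'k::field, 'z) operad_scheme \<Rightarrow>
      ('c \<times> ('p \<times> nat list) list) \<Rightarrow> 'p list \<Rightarrow> (('c \<times> ('p \<times> nat list) list) \<Rightarrow>\<^sub>0 'k)"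
  where "ract_compos P = (\<lambda>(c, qs) rs. lin (\<lambda>es. bv (c, es))
    (tens (map (\<lambda>(q, l). lin (\<lambda>y. bv (y, concat (map (block (ar P) rs) l)))
      (gam P q (map ((!) rs) l))) qs)))"

text \<open>
  On \<open>P \<circ>\<^sub>(\<^sub>1\<^sub>) N\<close>: the operations above the distinguished factor act on it, the others are composed
  with the root.
\<close>

definition ract_compos1 :: "('p, 'k::field, 'z) operad_scheme \<Rightarrow> ('n \<Rightarrow> 'p list \<Rightarrow> ('n \<Rightarrow>\<^sub>0 'k)) \<Rightarrow>
      ('p \<times> ((unit + 'n) \<times> nat list) list) \<Rightarrow> 'p list \<Rightarrow>
      (('p \<times> ((unit + 'n) \<times> nat list) list) \<Rightarrow>\<^sub>0 'k)"
  where "ract_compos1 P \<rho> = (\<lambda>(p, slots) rs. lin (graft P p)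
    (tens (map (\<lambda>(s, l). case s of
        Inl _ \<Rightarrow> bv (rs ! (l ! 0), leaves_of (block (ar P) rs (l ! 0)))
      | Inr x \<Rightarrow> lin (\<lambda>y. bv (one P, [(Inr y, concat (map (block (ar P) rs) l))]))
          (\<rho> x (map ((!) rs) l))) slots)))"

text \<open>
  \<open>M \<circ>\<^sub>P N\<close> for a right action \<open>\<rho>\<close> on \<open>M\<close> and a left action \<open>\<lambda>\<close> on \<open>N\<close> (in the same format as
  \<open>gam\<close>): the coequalizer of \<open>id \<circ> \<lambda>\<close> and \<open>\<rho> \<circ> id\<close> on \<open>M \<circ> P \<circ> N\<close>.
\<close>

definition rel_compos :: "('p, 'k::field, 'z) operad_scheme \<Rightarrow>
      ('m, 'k, 'u) dgs_scheme \<Rightarrow> ('m \<Rightarrow> 'p list \<Rightarrow> ('m \<Rightarrow>\<^sub>0 'k)) \<Rightarrow>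
      ('n, 'k, 'w) dgs_scheme \<Rightarrow> ('p \<Rightarrow> 'n list \<Rightarrow> ('n \<Rightarrow>\<^sub>0 'k)) \<Rightarrow>
      ('m \<times> ('n \<times> nat list) list, 'k) dgs"
  where "rel_compos P M \<rho> N lact = (compos M N)\<lparr>rels := vec.span (compos_rels M N \<union>
    {lin (\<lambda>es. bv (m, es))
        (tens (map (\<lambda>((r, ns), l). lin (\<lambda>y. bv (y, concat (map snd (unfold_labels ns l))))
          (lact r (map fst ns))) xs))
      - lin (\<lambda>m'. bv (m', concat (map (\<lambda>((r, ns), l). unfold_labels ns l) xs)))
          (\<rho> m (map (\<lambda>((r, ns), l). r) xs)) |m xs.
      (m, xs) \<in> gens (compos M (compos P N))})\<rparr>"

text \<open>\<open>I\<close> as a left \<open>P\<close>-module.\<close>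

definition unit_lact :: "('p, 'k::field, 'z) operad_scheme \<Rightarrow> 'p \<Rightarrow> unit list \<Rightarrow> (unit \<Rightarrow>\<^sub>0 'k)"
  where "unit_lact P r us = scl (aug P r) (bv ())"


section \<open>The module of obstructions\<close>

subsection \<open>The cotangent complex\<close>

text \<open>
  A generator of \<open>L\<^sub>P = P \<circ>\<^sub>(\<^sub>1\<^sub>) (C \<circ> P)\<close> is a pair \<open>(p, slots)\<close>, where exactly one entry of \<open>slots\<close> has
  the form \<open>(Inr (c, qs), l)\<close>; the others are leaves.  In \<open>L_left\<close>, the factors of \<open>qs\<close> not attached
  to the remaining factor \<open>c''\<close> are composed with \<open>\<alpha>(c')\<close>, and the result is composed with \<open>p\<close>.
\<close>

definition L_left :: "('p, 'k::field, 'z) operad_scheme \<Rightarrow> ('c, 'k, 'w) cooperad_scheme \<Rightarrow>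
      ('c \<Rightarrow> ('p \<Rightarrow>\<^sub>0 'k)) \<Rightarrow>
      ('p \<times> ((unit + 'c \<times> ('p \<times> nat list) list) \<times> nat list) list) \<Rightarrow>
      (('p \<times> ((unit + 'c \<times> ('p \<times> nat list) list) \<times> nat list) list) \<Rightarrow>\<^sub>0 'k)"
  where "L_left P C \<alpha> = (\<lambda>(p, slots). \<Sum>v<length slots. case slots ! v of
      (Inl _, l) \<Rightarrow> 0
    | (Inr (c, qs), l) \<Rightarrow> (let Q = unfold_labels qs l in
        lin (\<lambda>(c', us). lin (\<lambda>a. lin (graft_at P p slots v)
            (graft P a (map (\<lambda>(u, i). case u of
                Inl _ \<Rightarrow> (fst (Q ! (i ! 0)), leaves_of (snd (Q ! (i ! 0))))
              | Inr c'' \<Rightarrow> (let (x, l') = fold_labels (ar P) c'' (map ((!) Q) i)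
                  in (one P, [(Inr x, l')]))) us)))
          (\<alpha> c'))
        (pcop C c)))"

text \<open>The sign comes from \<open>\<alpha>\<close>, of degree -1, passing \<open>c'\<close>.\<close>

definition L_right :: "('p, 'k::field, 'z) operad_scheme \<Rightarrow> ('c, 'k, 'w) cooperad_scheme \<Rightarrow>
      ('c \<Rightarrow> ('p \<Rightarrow>\<^sub>0 'k)) \<Rightarrow>
      ('p \<times> ((unit + 'c \<times> ('p \<times> nat list) list) \<times> nat list) list) \<Rightarrow>
      (('p \<times> ((unit + 'c \<times> ('p \<times> nat list) list) \<times> nat list) list) \<Rightarrow>\<^sub>0 'k)"
  where "L_right P C \<alpha> = (\<lambda>(p, slots). \<Sum>v<length slots. case slots ! v of
      (Inl _, l) \<Rightarrow> 0
    | (Inr (c, qs), l) \<Rightarrow> (let Q = unfold_labels qs l in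
        lin (\<lambda>(c', us). scl (ksgn (deg C c'))
          (lin (\<lambda>es. let (x, l') = fold_labels (ar P) c' es in bv (p, slots[v := (Inr x, l')]))
            (tens (map (\<lambda>(u, i). case u of
                Inl _ \<Rightarrow> bv (Q ! (i ! 0))
              | Inr c'' \<Rightarrow> lin (\<lambda>a. lin (\<lambda>y. bv (y, concat (map (\<lambda>b. snd (Q ! b)) i)))
                    (gam P a (map (\<lambda>b. fst (Q ! b)) i)))
                  (\<alpha> c'')) us))))
        (pcop C c)))"

definition L_mod :: "('p, 'k::field, 'z) operad_scheme \<Rightarrow> ('c, 'k, 'w) cooperad_scheme \<Rightarrow>
      ('c \<Rightarrow> ('p \<Rightarrow>\<^sub>0 'k)) \<Rightarrow> ('p \<times> ((unit + 'c \<times> ('p \<times> nat list) list) \<times> nat list) list, 'k) dgs"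
  where "L_mod P C \<alpha> = (let K = compos1 P (compos C P)
    in K\<lparr>bd := (\<lambda>x. bd K x - L_left P C \<alpha> x + L_right P C \<alpha> x)\<rparr>)"

definition Lbar_mod :: "('p, 'k::field, 'z) operad_scheme \<Rightarrow> ('c, 'k, 'w) cooperad_scheme \<Rightarrow>
      ('c \<Rightarrow> ('p \<Rightarrow>\<^sub>0 'k)) \<Rightarrow>
      (('p \<times> ((unit + 'c \<times> ('p \<times> nat list) list) \<times> nat list) list) \<times> (unit \<times> nat list) list, 'k) dgs"
  where "Lbar_mod P C \<alpha> =
    rel_compos P (L_mod P C \<alpha>) (ract_compos1 P (ract_compos P)) unit_dgs (unit_lact P)"


subsection \<open>The module of Kaehler differential forms\<close>

text \<open>The maps \<open>id \<circ>\<^sub>(\<^sub>1\<^sub>) \<gamma>\<close> and \<open>c\<^sub>2\<close> from \<open>P \<circ>\<^sub>(\<^sub>1\<^sub>) (P \<circ> P)\<close> to \<open>P \<circ>\<^sub>(\<^sub>1\<^sub>) P\<close>.\<close>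

definition Omega_c1 :: "('p, 'k::field, 'z) operad_scheme \<Rightarrow>
      ('p \<times> ((unit + 'p \<times> ('p \<times> nat list) list) \<times> nat list) list) \<Rightarrow>
      (('p \<times> ((unit + 'p) \<times> nat list) list) \<Rightarrow>\<^sub>0 'k)"
  where "Omega_c1 P = (\<lambda>(p, slots). lin (\<lambda>es. bv (p, es))
    (tens (map (\<lambda>(s, l). case s of
        Inl _ \<Rightarrow> bv (Inl (), l)
      | Inr (q, rs) \<Rightarrow> lin (\<lambda>y. bv (Inr y, concat (map snd (unfold_labels rs l))))
          (gam P q (map fst rs))) slots)))"

definition Omega_c2 :: "('p, 'k::field, 'z) operad_scheme \<Rightarrow>
      ('p \<times> ((unit + 'p \<times> ('p \<times> nat list) list) \<times> nat list) list) \<Rightarrow>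
      (('p \<times> ((unit + 'p) \<times> nat list) list) \<Rightarrow>\<^sub>0 'k)"
  where "Omega_c2 P = (\<lambda>(p, slots). \<Sum>v<length slots. case slots ! v of
      (Inl _, l) \<Rightarrow> 0
    | (Inr (q, rs), l) \<Rightarrow> (let R = unfold_labels rs l;
          slots' = map (\<lambda>(s, l). (Inl (), l)) slots
        in \<Sum>j<length R. lin (graft_at P p slots' v)
          (graft P q (map (\<lambda>i. if i = j then (one P, [(Inr (fst (R ! i)), snd (R ! i))])
            else (fst (R ! i), leaves_of (snd (R ! i)))) [0..<length R]))))"

text \<open>Both maps are morphisms of infinitesimal bimodules, so that their coequalizer is the quotient of
  \<open>P \<circ>\<^sub>(\<^sub>1\<^sub>) P\<close> by the image of their difference.\<close>

definition Omega_mod :: "('p, 'k::field, 'z) operad_scheme \<Rightarrow>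
      ('p \<times> ((unit + 'p) \<times> nat list) list, 'k) dgs"
  where "Omega_mod P = (let K = compos1 P P
    in K\<lparr>rels := vec.span (rels K \<union>
      {Omega_c1 P x - Omega_c2 P x |x. x \<in> gens (compos1 P (compos P P))})\<rparr>)"

definition Omegabar_mod :: "('p, 'k::field, 'z) operad_scheme \<Rightarrow>
      (('p \<times> ((unit + 'p) \<times> nat list) list) \<times> (unit \<times> nat list) list, 'k) dgs"
  where "Omegabar_mod P = rel_compos P (Omega_mod P) (ract_compos1 P (gam P)) unit_dgs (unit_lact P)"


subsection \<open>The kernel and its homology\<close>

text \<open>\<open>L\<^sub>P \<rightarrow> P \<circ>\<^sub>(\<^sub>1\<^sub>) P\<close>.  The counit vanishes outside arity 1, so that only \<open>qs\<close> of length 1 matter.\<close>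

definition L_proj :: "('c, 'k::field, 'w) cooperad_scheme \<Rightarrow>
      ('p \<times> ((unit + 'c \<times> ('p \<times> nat list) list) \<times> nat list) list) \<Rightarrow>
      (('p \<times> ((unit + 'p) \<times> nat list) list) \<Rightarrow>\<^sub>0 'k)"
  where "L_proj C = (\<lambda>(p, slots). lin (\<lambda>es. bv (p, es))
    (tens (map (\<lambda>(s, l). case s of
        Inl _ \<Rightarrow> bv (Inl (), l)
      | Inr (c, qs) \<Rightarrow> scl (cou C c) (bv (Inr (fst (qs ! 0)), map ((!) l) (snd (qs ! 0))))) slots)))"

definition Lbar_proj :: "('c, 'k::field, 'w) cooperad_scheme \<Rightarrow>
      (('p \<times> ((unit + 'c \<times> ('p \<times> nat list) list) \<times> nat list) list) \<times> (unit \<times> nat list) list) \<Rightarrow>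
      ((('p \<times> ((unit + 'p) \<times> nat list) list) \<times> (unit \<times> nat list) list) \<Rightarrow>\<^sub>0 'k)"
  where "Lbar_proj C = (\<lambda>(x, us). lin (\<lambda>y. bv (y, us)) (L_proj C x))"

text \<open>
  Complexes of S-modules as subquotients: in arity \<open>n\<close> and degree \<open>d\<close> the quotient of the space
  \<open>elts n d\<close> by its subspace \<open>null n d\<close>.
\<close>

record (overloaded) ('x, 'k) subquot =
  elts :: "nat \<Rightarrow> int \<Rightarrow> ('x \<Rightarrow>\<^sub>0 'k) set"
  null :: "nat \<Rightarrow> int \<Rightarrow> ('x \<Rightarrow>\<^sub>0 'k) set"
  dd :: "('x \<Rightarrow>\<^sub>0 'k) \<Rightarrow> ('x \<Rightarrow>\<^sub>0 'k)"

definition kernel :: "('x, 'k::field, 'z) dgs_scheme \<Rightarrow> ('y, 'k, 'w) dgs_scheme \<Rightarrow>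
      ('x \<Rightarrow> ('y \<Rightarrow>\<^sub>0 'k)) \<Rightarrow> ('x, 'k) subquot"
  where "kernel M N f = \<lparr>
    elts = (\<lambda>n d. {v \<in> hcomp M n d. lin f v \<in> rels N}),
    null = (\<lambda>n d. hcomp M n d \<inter> rels M),
    dd = lin (bd M)\<rparr>"

definition cycles :: "('x, 'k::field) subquot \<Rightarrow> int \<Rightarrow> nat \<Rightarrow> ('x \<Rightarrow>\<^sub>0 'k) set"
  where "cycles X d n = {z \<in> elts X n d. dd X z \<in> null X n (d - 1)}"

definition boundaries :: "('x, 'k::field) subquot \<Rightarrow> int \<Rightarrow> nat \<Rightarrow> ('x \<Rightarrow>\<^sub>0 'k) set"
  where "boundaries X d n = {dd X y + r |y r. y \<in> elts X n (d + 1) \<and> r \<in> null X n d}"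

text \<open>The set of homology classes; its zero element is the coset \<open>boundaries X d n\<close>.\<close>

definition homology :: "('x, 'k::field) subquot \<Rightarrow> int \<Rightarrow> nat \<Rightarrow> ('x \<Rightarrow>\<^sub>0 'k) set set"
  where "homology X d n = (\<lambda>z. (+) z ` boundaries X d n) ` cycles X d n"

definition obstruction :: "('p, 'k::field, 'z) operad_scheme \<Rightarrow> ('c, 'k, 'w) cooperad_scheme \<Rightarrow>
      ('c \<Rightarrow> ('p \<Rightarrow>\<^sub>0 'k)) \<Rightarrow>
      (('p \<times> ((unit + 'c \<times> ('p \<times> nat list) list) \<times> nat list) list) \<times> (unit \<times> nat list) list, 'k) subquot"
  where "obstruction P C \<alpha> = kernel (Lbar_mod P C \<alpha>) (Omegabar_mod P) (Lbar_proj C)"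


section \<open>The bar construction\<close>

text \<open>
  The cofree cooperad on the suspension of the augmentation ideal of \<open>P\<close>: trees with vertices
  labelled by generators of \<open>P\<close> other than \<open>one\<close>, each of degree 1 (as \<open>P\<close> is in degree 0).  The
  vertices of a tree are ordered as they appear in \<open>Vtx p [t\<^sub>0, \<dots>, t\<^sub>k\<^sub>-\<^sub>1]\<close>, first \<open>p\<close>, then those of
  \<open>t\<^sub>0\<close>, and so on; this fixes the signs.
\<close>

datatype 'x tree = Leaf nat | Vtx 'x "'x tree list"

primrec tleaves :: "'x tree \<Rightarrow> nat list" where
  "tleaves (Leaf a) = [a]"
| "tleaves (Vtx p ts) = concat (map tleaves ts)"

primrec tdeg :: "'x tree \<Rightarrow> int" where
  "tdeg (Leaf a) = 0"
| "tdeg (Vtx p ts) = 1 + sum_list (map tdeg ts)"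

primrec trelabel :: "(nat \<Rightarrow> nat) \<Rightarrow> 'x tree \<Rightarrow> 'x tree" where
  "trelabel s (Leaf a) = Leaf (s a)"
| "trelabel s (Vtx p ts) = Vtx p (map (trelabel s) ts)"

primrec tvalid :: "('x, 'k::field, 'z) operad_scheme \<Rightarrow> 'x tree \<Rightarrow> bool" where
  "tvalid P (Leaf a) = True"
| "tvalid P (Vtx p ts) = (p \<in> gens P - {one P} \<and> length ts = ar P p \<and> list_all (tvalid P) ts)"

definition tree_gens :: "('x, 'k::field, 'z) operad_scheme \<Rightarrow> 'x tree set"
  where "tree_gens P = {t. tvalid P t \<and> distinct (tleaves t) \<and> set (tleaves t) = {..<length (tleaves t)}}"

inductive_set tree_rels :: "('x, 'k::field, 'z) operad_scheme \<Rightarrow> ('x tree \<Rightarrow>\<^sub>0 'k) set" for P where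
  tree_rels_vertex: "r \<in> rels P \<Longrightarrow> lin (\<lambda>p. bv (Vtx p ts)) r \<in> tree_rels P"
| tree_rels_perm: "p \<in> gens P \<Longrightarrow> s permutes {..<ar P p} \<Longrightarrow> length ts = ar P p \<Longrightarrow>
    lin (\<lambda>p'. bv (Vtx p' ts)) (act P s p)
      - scl (perm_sgn (map tdeg ts) s) (bv (Vtx p (map (\<lambda>i. ts ! s i) [0..<ar P p]))) \<in> tree_rels P"
| tree_rels_child: "r \<in> tree_rels P \<Longrightarrow> i < length ts \<Longrightarrow>
    lin (\<lambda>t. bv (Vtx p (ts[i := t]))) r \<in> tree_rels P"

text \<open>The differential contracts the inner edges.\<close>

primrec tree_bd :: "('x, 'k::field, 'z) operad_scheme \<Rightarrow> 'x tree \<Rightarrow> ('x tree \<Rightarrow>\<^sub>0 'k)" where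
  "tree_bd P (Leaf a) = 0"
| "tree_bd P (Vtx p ts) =
    (\<Sum>i<length ts. case ts ! i of
        Leaf _ \<Rightarrow> 0
      | Vtx q us \<Rightarrow> scl (ksgn (sum_list (map tdeg (take i ts))))
          (lin (\<lambda>x. bv (Vtx x (take i ts @ us @ drop (Suc i) ts)))
            (gam P p ((replicate (length ts) (one P))[i := q]))))
    + (\<Sum>i<length ts. scl (ksgn (1 + sum_list (map tdeg (take i ts))))
        (lin (\<lambda>t. bv (Vtx p (ts[i := t]))) (map (tree_bd P) ts ! i)))"

text \<open>A tree with its leaves renumbered \<open>0, 1, \<dots>\<close> from left to right, together with its old labels.\<close>

definition tstd :: "'x tree \<Rightarrow> 'x tree \<times> nat list"
  where "tstd t = (let w = tleaves t in (trelabel (\<lambda>a. length (takeWhile (\<lambda>b. b \<noteq> a) w)) t, w))"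

text \<open>
  The decomposition cuts a tree into a lower tree and the forest of the upper trees, in all possible
  ways: either below the root vertex, or above it, in which case the cuts of the subtrees are put
  together.  The sign is that of \<open>t\<^sub>0 U\<^sub>0 t\<^sub>1 U\<^sub>1 \<dots> \<mapsto> t\<^sub>0 t\<^sub>1 \<dots> U\<^sub>0 U\<^sub>1 \<dots>\<close> for the cuts \<open>(t\<^sub>i, U\<^sub>i)\<close> of the
  subtrees.
\<close>

definition join_cuts :: "'x \<Rightarrow> ('x tree \<times> ('x tree \<times> nat list) list) list \<Rightarrow>
      (('x tree \<times> ('x tree \<times> nat list) list) \<Rightarrow>\<^sub>0 'k::field)"
  where "join_cuts p ds =
    scl (\<Prod>(i, j)\<in>{(i, j). i < j \<and> j < length ds}.
          ksgn ((\<Sum>(u, l)\<leftarrow>snd (ds ! i). tdeg u) * tdeg (fst (ds ! j))))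
      (bv (Vtx p (map (\<lambda>i. trelabel ((!) (block (\<lambda>(t, U). length U) ds i)) (fst (ds ! i))) [0..<length ds]),
        concat (map snd ds)))"

primrec tree_cop :: "'x tree \<Rightarrow> (('x tree \<times> ('x tree \<times> nat list) list) \<Rightarrow>\<^sub>0 'k::field)" where
  "tree_cop (Leaf a) = bv (Leaf 0, [(Leaf 0, [a])])"
| "tree_cop (Vtx p ts) = bv (Leaf 0, [tstd (Vtx p ts)]) + lin (join_cuts p) (tens (map tree_cop ts))"

definition Bar :: "('x, 'k::field, 'z) operad_scheme \<Rightarrow> ('x tree, 'k) cooperad"
  where "Bar P = \<lparr>
    gens = tree_gens P,
    ar = (\<lambda>t. length (tleaves t)),
    deg = tdeg,
    rels = vec.span {r \<in> tree_rels P. Poly_Mapping.keys r \<subseteq> tree_gens P},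
    act = (\<lambda>s t. bv (trelabel s t)),
    bd = tree_bd P,
    cop = tree_cop,
    cou = (\<lambda>t. case t of Leaf _ \<Rightarrow> 1 | Vtx _ _ \<Rightarrow> 0)\<rparr>"

text \<open>The Koszul morphism \<open>\<pi> : Bar P \<rightarrow> P\<close>: projection on the trees with one vertex.\<close>

definition bar_pi :: "('x, 'k::field, 'z) operad_scheme \<Rightarrow> 'x tree \<Rightarrow> ('x \<Rightarrow>\<^sub>0 'k)"
  where "bar_pi P t = (case t of
      Leaf _ \<Rightarrow> 0
    | Vtx p ts \<Rightarrow> (if tdeg t = 1
        then act P (\<lambda>i. if i < length ts then tleaves t ! i else i) p else 0))"


section \<open>The operad Perm\<close>

text \<open>\<open>(n, i)\<close> with \<open>i < n\<close> is the basis element \<open>e\<close> of \<open>Perm(n)\<close> with the input \<open>i\<close> underlined,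
  inputs being numbered from 0.\<close>

definition Perm :: "(nat \<times> nat, 'k::field) operad"
  where "Perm = \<lparr>
    gens = {(n, i). i < n},
    ar = fst,
    deg = (\<lambda>_. 0),
    rels = {0},
    act = (\<lambda>s (n, i). bv (n, s i)),
    bd = (\<lambda>_. 0),
    gam = (\<lambda>(k, i) es. bv (\<Sum>e\<leftarrow>es. fst e, (\<Sum>e\<leftarrow>take i es. fst e) + snd (es ! i))),
    one = (1, 0)\<rparr>"

text \<open>
  The obstructions of an operad do not depend, up to quasi-isomorphism, on the Koszul morphism used
  to define them; for \<open>Perm\<close> the universal one, from the bar construction, is used.
\<close>

definition O_Perm
  where "O_Perm = obstruction (Perm :: (nat \<times> nat, 'k::field_char_0) operad) (Bar Perm) (bar_pi Perm)"

end

theory Submission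
  imports Defs
begin

text \<open>
  Tensoring with \<open>I\<close> over \<open>Perm\<close> kills whatever an operation of arity at least 2 acts on from above.
  A generator of \<open>Lbar\<close> is therefore a root \<open>p\<close> of \<open>Perm\<close>, one input of which carries a cell \<open>c\<close> of the
  bar construction while the others are leaves.  If at least two inputs of \<open>p\<close> are leaves, \<open>p\<close> factors through
  an operation on these leaves, and the generator is zero: only roots of arity 1 and 2 survive.  On them the
  differential is that of the bar construction minus, for the root of arity 1, the map that cuts a
  binary root vertex off \<open>c\<close> and makes it the new root.

  In arity 3 and degree 1 the cell is a corolla, and \<open>\<gamma>(p; \<pi>(c))\<close> is an element of \<open>Perm(3)\<close>.
  In arity 3 and degree 2 the root has arity 1 and \<open>c\<close> has two binary vertices \<open>v\<close> and \<open>w\<close>.  Its boundary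
  is the contraction of the inner edge minus the result of cutting this edge; the composite in \<open>Perm(3)\<close>
  is \<open>v \<circ> w\<close> for both, up to relabelling, so that \<open>\<gamma>(p; \<pi>(c))\<close> vanishes on boundaries.  But it is
  non-zero on a binary corolla grafted on a binary root, and this is a cycle: cutting its only vertex gives
  a root of arity 3.  So there is a non-zero homology class in arity 3.  It lies in the kernel of
  \<open>Lbar \<rightarrow> Omegabar\<close>, because the counit vanishes on corollas.

  Instead of \<open>\<gamma>(p; \<pi>(c))\<close> itself, the proof uses the sum of its coordinates, called the weight.  This sum
  is the same for all labellings and all choices of underlined inputs, so that it depends on the shapes
  of the trees only.  The lemma \<open>Lbar_rels_wt\<close> shows that the weight is well defined on the quotient
  \<open>Lbar\<close>, \<open>Lbar_bd_wt\<close> that it vanishes on boundaries, and \<open>witness_cycle\<close> provides the cycle.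
\<close>

section \<open>Linear forms on free vector spaces\<close>

definition form :: "('x \<Rightarrow> 'k) \<Rightarrow> ('x \<Rightarrow>\<^sub>0 'k::field) \<Rightarrow> 'k"
  where "form f v = (\<Sum>x\<in>Poly_Mapping.keys v. Poly_Mapping.lookup v x * f x)"

lemma form_superset:
  assumes "finite A" "Poly_Mapping.keys v \<subseteq> A"
  shows "form f v = (\<Sum>x\<in>A. Poly_Mapping.lookup v x * f x)"
  unfolding form_def using assms by (intro sum.mono_neutral_left) (auto simp: in_keys_iff)

lemma form_zero [simp]: "form f 0 = 0"
  by (simp add: form_def)

lemma form_add [simp]: "form f (v + w) = form f v + form f w"
proof -
  let ?A = "Poly_Mapping.keys v \<union> Poly_Mapping.keys w"
  have "Poly_Mapping.keys (v + w) \<subseteq> ?A" by (rule keys_add)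
  then show ?thesis
    by (simp add: form_superset[of ?A] lookup_add algebra_simps sum.distrib)
qed

lemma form_scl [simp]: "form f (scl c v) = c * form f v"
proof -
  have "Poly_Mapping.keys (scl c v) \<subseteq> Poly_Mapping.keys v"
    by (auto simp: in_keys_iff lookup_scl)
  then show ?thesis
    by (simp add: form_superset[of "Poly_Mapping.keys v"] lookup_scl sum_distrib_left mult.assoc)
qed

lemma form_diff [simp]: "form f (v - w) = form f v - form f w"
  using form_add[of f "v - w" w] by (simp add: eq_diff_eq)

lemma form_sum [simp]: "form f (sum g A) = (\<Sum>a\<in>A. form f (g a))"
  by (induction A rule: infinite_finite_induct) auto

lemma form_bv [simp]: "form f (bv x) = f x"
  by (simp add: form_def bv_def)

lemma bv_eq_iff [simp]: "bv x = (bv y :: _ \<Rightarrow>\<^sub>0 'k::field) \<longleftrightarrow> x = y"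
proof
  assume "bv x = (bv y :: _ \<Rightarrow>\<^sub>0 'k)"
  then have "form (\<lambda>z. of_bool (z = x)) (bv x) = (form (\<lambda>z. of_bool (z = x)) (bv y) :: 'k)" by simp
  then show "x = y" unfolding form_bv by (cases "x = y") auto
qed simp

lemma form_const_zero [simp]: "form (\<lambda>_. 0) v = 0"
  by (simp add: form_def)

lemma form_cmult: "form (\<lambda>x. c * f x) v = c * form f v"
  by (simp add: form_def sum_distrib_left mult.left_commute)

lemma form_lin [simp]: "form f (lin g v) = form (\<lambda>x. form f (g x)) v"
  by (simp add: lin_def form_def[of _ v])

lemma form_span:
  assumes "v \<in> vec.span S" "\<And>s. s \<in> S \<Longrightarrow> form f s = 0"
  shows "form f v = 0"
  using assms by (induction rule: vec.span_induct_alt) auto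

lemma lin_superset:
  assumes "finite A" "Poly_Mapping.keys v \<subseteq> A"
  shows "lin f v = (\<Sum>x\<in>A. scl (Poly_Mapping.lookup v x) (f x))"
  unfolding lin_def using assms by (intro sum.mono_neutral_left) (auto simp: in_keys_iff)

lemma lin_zero [simp]: "lin f 0 = 0"
  by (simp add: lin_def)

lemma lin_add [simp]: "lin f (v + w) = lin f v + lin f w"
proof -
  let ?A = "Poly_Mapping.keys v \<union> Poly_Mapping.keys w"
  have "Poly_Mapping.keys (v + w) \<subseteq> ?A" by (rule keys_add)
  then show ?thesis
    by (simp add: lin_superset[of ?A] lookup_add vec.scale_left_distrib sum.distrib)
qed

lemma lin_bv [simp]: "lin f (bv x) = f x"
  by (simp add: lin_def bv_def)

lemma lin_scl [simp]: "lin f (scl c v) = scl c (lin f v)"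
proof -
  have "Poly_Mapping.keys (scl c v) \<subseteq> Poly_Mapping.keys v"
    by (auto simp: in_keys_iff lookup_scl)
  then show ?thesis
    by (simp add: lin_superset[of "Poly_Mapping.keys v"] lookup_scl vec.scale_sum_right)
qed

lemma lin_diff [simp]: "lin f (v - w) = lin f v - lin f w"
  using lin_add[of f "v - w" w] by (simp add: eq_diff_eq)

lemma lin_const_zero [simp]: "lin (\<lambda>_. 0) v = 0"
  by (simp add: lin_def)

lemma tens_bv [simp]: "tens (map (\<lambda>x. bv (f x)) xs) = bv (map f xs)"
  by (induction xs) auto

lemma tens_zero: "0 \<in> set vs \<Longrightarrow> tens vs = 0"
  by (induction vs) auto

text \<open>
  If at most one factor has non-zero degree, no two odd factors are interchanged.  This is the case when
  the degrees are non-negative and add up to at most 1, which is why the weight involves no signs.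
\<close>

lemma perm_sgn_zero:
  assumes "s permutes {..<length ds}" "\<And>i j. i < length ds \<Longrightarrow> j < length ds \<Longrightarrow> i \<noteq> j \<Longrightarrow> ds ! i * ds ! j = 0"
  shows "perm_sgn ds s = 1"
proof -
  have "ksgn (ds ! s i * ds ! s j) = (1::'a)" if "i < j" "j < length ds" for i j
  proof -
    have "s i \<noteq> s j" using permutes_inj[OF assms(1)] that by (auto dest: injD)
    moreover have "s i < length ds" "s j < length ds"
      using permutes_in_image[OF assms(1)] that by auto
    ultimately have "ds ! s i * ds ! s j = 0" using assms(2) by blast
    then show ?thesis by (simp only: ksgn_def even_zero if_True)
  qed
  then show ?thesis unfolding perm_sgn_def by (intro prod.neutral) auto
qed

section \<open>Projections of the records\<close>

lemma Perm_simps [simp]: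
  "gens Perm = {(n, i). i < n}" "ar Perm = fst" "deg Perm = (\<lambda>_. 0)" "rels Perm = {0}"
  "act Perm = (\<lambda>s (n, i). bv (n, s i))" "bd Perm = (\<lambda>_. 0)" "one Perm = (1, 0)"
  "gam Perm = (\<lambda>(k, i) es. bv (\<Sum>e\<leftarrow>es. fst e, (\<Sum>e\<leftarrow>take i es. fst e) + snd (es ! i)))"
  by (simp_all add: Perm_def)

lemma unit_dgs_simps [simp]:
  "gens unit_dgs = UNIV" "ar unit_dgs = (\<lambda>_. 1)" "deg unit_dgs = (\<lambda>_. 0)" "rels unit_dgs = {0}"
  "act unit_dgs = (\<lambda>_ x. bv x)" "bd unit_dgs = (\<lambda>_. 0)"
  by (simp_all add: unit_dgs_def)

lemma Bar_simps [simp]: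
  "gens (Bar P) = tree_gens P" "ar (Bar P) = (\<lambda>t. length (tleaves t))" "deg (Bar P) = tdeg"
  "rels (Bar P) = vec.span {r \<in> tree_rels P. Poly_Mapping.keys r \<subseteq> tree_gens P}"
  "act (Bar P) = (\<lambda>s t. bv (trelabel s t))" "bd (Bar P) = tree_bd P"
  "cop (Bar P) = tree_cop" "cou (Bar P) = (\<lambda>t. case t of Leaf _ \<Rightarrow> 1 | Vtx _ _ \<Rightarrow> 0)"
  by (simp_all add: Bar_def)

lemma compos_simps [simp]:
  "gens (compos M N) = compos_gens M N"
  "ar (compos M N) = (\<lambda>(m, ns). length (concat (map snd ns)))"
  "deg (compos M N) = (\<lambda>(m, ns). deg M m + (\<Sum>(x, l)\<leftarrow>ns. deg N x))"
  "rels (compos M N) = compos_rels M N"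
  "act (compos M N) = (\<lambda>s (m, ns). bv (m, map (\<lambda>(x, l). (x, map s l)) ns))"
  by (simp_all add: compos_def)

lemma dsum_simps [simp]:
  "gens (dsum M N) = Inl ` gens M \<union> Inr ` gens N"
  "ar (dsum M N) = case_sum (ar M) (ar N)"
  "deg (dsum M N) = case_sum (deg M) (deg N)"
  by (simp_all add: dsum_def)

section \<open>The weight of a cell\<close>

lemma tdeg_nonneg [simp]: "0 \<le> tdeg t"
proof (induction t)
  case (Vtx p ts)
  then have "0 \<le> sum_list (map tdeg ts)" by (intro sum_list_nonneg) auto
  then show ?case by simp
qed simp

lemma sum_list_tdeg_nonneg [simp]: "0 \<le> sum_list (map tdeg ts)"
  by (intro sum_list_nonneg) auto

lemma tdeg_trelabel [simp]: "tdeg (trelabel s t) = tdeg t"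
  by (induction t) (auto intro!: arg_cong[of _ _ sum_list])

lemma tleaves_trelabel [simp]: "tleaves (trelabel s t) = map s (tleaves t)"
  by (induction t) (auto simp: map_concat intro!: arg_cong[of _ _ concat])

lemma mset_map_nth_permutes:
  assumes "s permutes {..<length xs}"
  shows "mset (map (\<lambda>i. xs ! s i) [0..<length xs]) = mset xs"
proof -
  have "map (\<lambda>i. xs ! s i) [0..<length xs] = permute_list s xs"
    by (simp add: permute_list_def)
  then show ?thesis by (simp add: mset_permute_list assms)
qed

lemma sum_list_map_nth_permutes:
  fixes f :: "'a \<Rightarrow> 'b::comm_monoid_add"
  assumes "s permutes {..<length xs}"
  shows "(\<Sum>i\<leftarrow>[0..<length xs]. f (xs ! s i)) = sum_list (map f xs)"
proof -
  have "mset (map (\<lambda>i. f (xs ! s i)) [0..<length xs]) = mset (map f xs)"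
    using arg_cong[OF mset_map_nth_permutes[OF assms], of "image_mset f"] by (simp add: image_mset.compositionality o_def)
  then show ?thesis by (metis sum_mset_sum_list)
qed

lemma set_map_nth_permutes:
  assumes "s permutes {..<length xs}"
  shows "(\<lambda>i. xs ! s i) ` {0..<length xs} = set xs"
  using arg_cong[OF mset_map_nth_permutes[OF assms], of set_mset] by simp

text \<open>
  For \<open>d = 1\<close> this is the indicator function of the corollas with \<open>n\<close> leaves.  As integers, \<open>d\<close> and \<open>n\<close>
  can be shifted freely when the other children of a vertex are split off.
\<close>

definition tree_wt :: "int \<Rightarrow> int \<Rightarrow> 'x tree \<Rightarrow> 'k::field"
  where "tree_wt d n t = of_bool (tdeg t = d \<and> int (length (tleaves t)) = n)"

lemma sum_list_map_update:
  "i < length xs \<Longrightarrow> sum_list (map f (xs[i := y])) = f y + sum_list (map f (xs[i := x])) - (f x :: int)"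
  by (induction xs arbitrary: i) (auto split: nat.splits)

lemma int_sum_list_map: "int (\<Sum>x\<leftarrow>xs. f x) = (\<Sum>x\<leftarrow>xs. int (f x))"
  by (induction xs) auto

text \<open>
  The relations are homogeneous in the degree and in the number of leaves, so only their signs could
  matter.  A tree of degree at most 1 has at most one vertex, and permuting its children, which are leaves,
  creates no sign.  The statement is proved for all \<open>d \<le> 1\<close> at once because fixing all children of a vertex
  but one lowers \<open>d\<close>.
\<close>

lemma tree_rels_wt:
  assumes "r \<in> tree_rels Perm" "d \<le> 1"
  shows "form (tree_wt d n) r = 0"
  using assms
proof (induction arbitrary: d n rule: tree_rels.induct)
  case (tree_rels_vertex r ts)
  then show ?case by simp
next
  case (tree_rels_perm p s ts)
  obtain k i where p: "p = (k, i)" by (cases p)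
  with tree_rels_perm have k: "length ts = k" and s: "s permutes {..<length ts}" by auto
  let ?ts' = "map (\<lambda>i. ts ! s i) [0..<k]"
  have deg': "sum_list (map tdeg ?ts') = sum_list (map tdeg ts)"
    using sum_list_map_nth_permutes[OF s, of tdeg] by (simp add: k o_def)
  have leaves': "(\<Sum>i\<leftarrow>[0..<k]. length (tleaves (ts ! s i))) = length (concat (map tleaves ts))"
    using sum_list_map_nth_permutes[OF s, of "length \<circ> tleaves"] by (simp add: k length_concat o_def)
  have wt: "tree_wt d n (Vtx (k, j) ?ts') = (tree_wt d n (Vtx (k, j') ts) :: 'a)" for j j'
    using deg' leaves' by (simp add: tree_wt_def length_concat o_def)
  have "perm_sgn (map tdeg ts) s = (1 :: 'a)" if "tree_wt d n (Vtx p ts) \<noteq> (0 :: 'a)"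
  proof (rule perm_sgn_zero)
    have "sum_list (map tdeg ts) \<le> 0"
      using that tree_rels_perm.prems by (auto simp: tree_wt_def split: if_splits)
    moreover have "tdeg t \<le> sum_list (map tdeg ts)" if "t \<in> set ts" for t
    proof -
      have "0 \<le> sum_list (map tdeg (remove1 t ts))" by simp
      then show ?thesis using sum_list_map_remove1[OF that, of tdeg] by linarith
    qed
    ultimately have "tdeg t = 0" if "t \<in> set ts" for t
      using that by (meson order_trans order_antisym tdeg_nonneg)
    then show "map tdeg ts ! i * map tdeg ts ! j = 0" if "i < length (map tdeg ts)" "j < length (map tdeg ts)" "i \<noteq> j" for i j
      using that by simp
  qed (use s in simp)
  moreover have "tree_wt d n (Vtx p ts) = (tree_wt d n (Vtx (k, s i) ts) :: 'a)"
    by (simp add: p tree_wt_def)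
  ultimately show ?case using wt[of i "s i"]
    by (cases "tree_wt d n (Vtx p ts) = (0 :: 'a)") (auto simp: p)
next
  case (tree_rels_child r i ts p)
  define D where "D = sum_list (map tdeg (ts[i := Leaf 0]))"
  define K where "K = sum_list (map (\<lambda>t. int (length (tleaves t))) (ts[i := Leaf 0])) - 1"
  have "0 \<le> D" unfolding D_def by simp
  have deg: "sum_list (map tdeg (ts[i := t])) = tdeg t + D" for t
    using sum_list_map_update[OF tree_rels_child.hyps(2), of tdeg t "Leaf 0"] by (simp add: D_def)
  have leaves: "int (length (tleaves (Vtx p (ts[i := t])))) = int (length (tleaves t)) + K" for t
    using sum_list_map_update[OF tree_rels_child.hyps(2), of "\<lambda>t. int (length (tleaves t))" t "Leaf 0"]
    by (simp add: K_def length_concat o_def int_sum_list_map)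
  \<comment> \<open>\<open>D\<close> and \<open>K\<close> are the degree and the number of leaves of the other children.\<close>
  have "tree_wt d n (Vtx p (ts[i := t])) = (tree_wt (d - 1 - D) (n - K) t :: 'a)" for t
    unfolding tree_wt_def leaves tdeg.simps deg by (rule arg_cong[of _ _ of_bool]) auto
  then show ?case using tree_rels_child.IH[of "d - 1 - D" "n - K"] tree_rels_child.prems \<open>0 \<le> D\<close> by simp
qed

text \<open>
  A factor of \<open>Perm\<close> above the cell is trivial if and only if it has arity 1.  The others die in \<open>Lbar\<close>.
\<close>

definition cell_wt :: "int \<Rightarrow> 'x tree \<times> ((nat \<times> nat) \<times> nat list) list \<Rightarrow> 'k::field"
  where "cell_wt n = (\<lambda>(c, qs). of_bool (\<forall>q\<in>set qs. fst (fst q) = 1) * tree_wt 1 n c)"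

lemma all_set_update:
  "j < length xs \<Longrightarrow>
    (\<forall>x\<in>set (xs[j := y]). Q x) \<longleftrightarrow> Q y \<and> (\<forall>i<length xs. i \<noteq> j \<longrightarrow> Q (xs ! i))"
  by (auto simp: all_set_conv_all_nth nth_list_update)

lemma compos_gens_D:
  assumes "(m, ns) \<in> compos_gens M N"
  shows "m \<in> gens M" "length ns = ar M m" "(x, l) \<in> set ns \<Longrightarrow> x \<in> gens N"
    "(x, l) \<in> set ns \<Longrightarrow> length l = ar N x" "distinct (concat (map snd ns))"
    "set (concat (map snd ns)) = {..<length (concat (map snd ns))}"
  using assms by (auto simp: compos_gens_def Let_def)

text \<open>
  Apart from the relations of the bar construction, those of the composition product preserve the tree up
  to relabelling and the multiset of the arities above it; operations of \<open>Perm\<close> have degree 0 and create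
  no signs.
\<close>

lemma cell_rels_wt:
  assumes "r \<in> compos_rels (Bar Perm) Perm"
  shows "form (cell_wt n) r = (0 :: 'k::field)"
  using assms unfolding compos_rels_def
proof (rule form_span, elim UnE)
  let ?B = "Bar Perm :: ((nat \<times> nat) tree, 'k) cooperad"
  fix v
  assume "v \<in> {lin (\<lambda>m. bv (m, ns)) r |r ns.
      r \<in> rels ?B \<and> (\<forall>m\<in>Poly_Mapping.keys r. (m, ns) \<in> compos_gens ?B Perm)}"
  then obtain r ns where v: "v = lin (\<lambda>m. bv (m, ns)) r" and r: "r \<in> rels ?B" by blast
  have "form (tree_wt 1 n) r = (0 :: 'k)"
    using r unfolding Bar_simps by (rule form_span) (auto intro: tree_rels_wt)
  then show "form (cell_wt n) v = 0"
    by (simp add: v cell_wt_def form_cmult)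
next
  let ?B = "Bar Perm :: ((nat \<times> nat) tree, 'k) cooperad"
  let ?P = "Perm :: (nat \<times> nat, 'k) operad"
  fix v
  assume "v \<in> {lin (\<lambda>y. bv (m, ns[j := (y, l)])) (act ?P s x)
        - bv (m, ns[j := (x, map (\<lambda>a. l ! s a) [0..<ar ?P x])]) |m ns j x l s.
      (m, ns) \<in> compos_gens ?B ?P \<and> j < length ns \<and> ns ! j = (x, l) \<and> s permutes {..<ar ?P x}}"
  then show "form (cell_wt n) v = 0"
    by (auto simp: cell_wt_def all_set_update)
next
  let ?B = "Bar Perm :: ((nat \<times> nat) tree, 'k) cooperad"
  let ?P = "Perm :: (nat \<times> nat, 'k) operad"
  fix v
  assume "v \<in> {lin (\<lambda>m'. bv (m', ns)) (act ?B s m)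
        - scl (perm_sgn (map (\<lambda>(x, l). deg ?P x) ns) s) (bv (m, map (\<lambda>i. ns ! s i) [0..<ar ?B m])) |m ns s.
      (m, ns) \<in> compos_gens ?B ?P \<and> s permutes {..<ar ?B m}}"
  then obtain m ns s where v: "v = lin (\<lambda>m'. bv (m', ns)) (act ?B s m)
        - scl (perm_sgn (map (\<lambda>(x, l). deg ?P x) ns) s) (bv (m, map (\<lambda>i. ns ! s i) [0..<ar ?B m]))"
    and g: "(m, ns) \<in> compos_gens ?B ?P" and s: "s permutes {..<ar ?B m}" by blast
  have len: "length ns = ar ?B m" using compos_gens_D[OF g] by simp
  have "perm_sgn (map (\<lambda>(x, l). deg ?P x) ns) s = (1 :: 'k)"
    by (rule perm_sgn_zero) (use s len in \<open>auto simp: case_prod_beta\<close>)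
  then show "form (cell_wt n) v = 0"
    using set_map_nth_permutes[of s ns] s len
    by (auto simp: v cell_wt_def tree_wt_def)
qed auto

text \<open>
  The root \<open>p\<close> is recorded by the number of its inputs only.  A cell with \<open>n\<close> leaves on a root of arity \<open>a\<close>
  has arity \<open>n + a - 1\<close> in total, so that in arity 3 a root of arity 1 goes with \<open>n = 3\<close> and a root of
  arity 2 with \<open>n = 2\<close>.
\<close>

fun slots_wt :: "(unit + 'x tree \<times> ((nat \<times> nat) \<times> nat list) list) list \<Rightarrow> 'k::field" where
  "slots_wt [Inr x] = cell_wt 3 x"
| "slots_wt [Inr x, Inl _] = cell_wt 2 x"
| "slots_wt [Inl _, Inr x] = cell_wt 2 x"
| "slots_wt _ = 0"

definition L_wt :: "'p \<times> ((unit + 'x tree \<times> ((nat \<times> nat) \<times> nat list) list) \<times> nat list) list \<Rightarrow> 'k::field"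
  where "L_wt = (\<lambda>(p, slots). slots_wt (map fst slots))"

lemma L_wt_simp [simp]: "L_wt (p, slots) = slots_wt (map fst slots)"
  by (simp add: L_wt_def)

lemma slots_wt_long: "length xs \<ge> 3 \<Longrightarrow> slots_wt xs = 0"
  by (induction xs rule: slots_wt.induct) auto

section \<open>The weight is well defined\<close>

lemma permutes_2_cases:
  assumes "s permutes {..<(2::nat)}"
  obtains "s 0 = 0" "s 1 = 1" | "s 0 = 1" "s 1 = 0"
proof -
  have "s 0 < 2" "s 1 < 2" "s 0 \<noteq> s 1"
    using permutes_in_image[OF assms] permutes_inj[OF assms] by (auto dest: injD)
  then show thesis using that by linarith
qed

lemma length_le_2_cases:
  obtains "xs = []" | x where "xs = [x]" | x y where "xs = [x, y]" | "length xs \<ge> 3"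
  by (cases xs; cases "tl xs"; cases "tl (tl xs)") auto

text \<open>
  There is a single cell of non-zero degree, so interchanging the two inputs of a binary root creates
  no sign either.
\<close>

lemma slots_rels_wt:
  assumes "r \<in> compos_rels Perm (dsum unit_dgs (compos (Bar Perm) Perm))"
  shows "form L_wt r = (0 :: 'k::field)"
  using assms unfolding compos_rels_def
proof (rule form_span, elim UnE)
  let ?P = "Perm :: (nat \<times> nat, 'k) operad"
  let ?N = "dsum unit_dgs (compos (Bar ?P) ?P)"
  fix v
  assume "v \<in> {lin (\<lambda>x. bv (m, ns[j := (x, l)])) r |r m ns j l.
      r \<in> rels ?N \<and> j < length ns \<and>
      (\<forall>x\<in>Poly_Mapping.keys r. (m, ns[j := (x, l)]) \<in> compos_gens ?P ?N)}"
  then obtain r m ns j l where v: "v = lin (\<lambda>x. bv (m, ns[j := (x, l)])) r"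
    and r: "r \<in> rels ?N" and j: "j < length ns" by blast
  have "form (\<lambda>x. slots_wt ((map fst ns)[j := x])) r = (0 :: 'k)"
    using r unfolding dsum_def dgs.simps
  proof (rule form_span)
    fix s
    assume "s \<in> lin (\<lambda>x. bv (Inl x)) ` rels unit_dgs \<union>
      lin (\<lambda>y. bv (Inr y)) ` rels (compos (Bar ?P) ?P)"
    then consider "s = 0" | r' where "s = lin (\<lambda>y. bv (Inr y)) r'" "r' \<in> compos_rels (Bar ?P) ?P"
      by auto
    then show "form (\<lambda>x. slots_wt ((map fst ns)[j := x])) s = (0 :: 'k)"
    proof cases
      case 2
      have cells: "form (cell_wt n) r' = (0 :: 'k)" for n
        using 2(2) by (rule cell_rels_wt)
      have "form (\<lambda>x. slots_wt ((map fst ns)[j := Inr x])) r' = (0 :: 'k)"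
      proof (cases "map fst ns" rule: length_le_2_cases)
        case (2 a)
        with j have "j = 0" by (cases ns) auto
        with 2 show ?thesis by (simp add: cells)
      next
        case (3 a b)
        with j have "length ns = 2" by (metis length_map length_Cons list.size(3) numeral_2_eq_2)
        with j have "j = 0 \<or> j = 1" by auto
        with 3 show ?thesis by (cases a; cases b) (auto simp: cells)
      next
        case 4
        then show ?thesis by (simp add: slots_wt_long)
      qed (use j in simp)
      then show ?thesis by (simp add: 2)
    qed simp
  qed
  then show "form L_wt v = 0" by (simp add: v map_update)
next
  let ?P = "Perm :: (nat \<times> nat, 'k) operad"
  let ?N = "dsum unit_dgs (compos (Bar ?P) ?P)"
  fix v
  assume "v \<in> {lin (\<lambda>y. bv (m, ns[j := (y, l)])) (act ?N s x)
        - bv (m, ns[j := (x, map (\<lambda>a. l ! s a) [0..<ar ?N x])]) |m ns j x l s.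
      (m, ns) \<in> compos_gens ?P ?N \<and> j < length ns \<and> ns ! j = (x, l) \<and> s permutes {..<ar ?N x}}"
  then obtain m ns j x l s where v: "v = lin (\<lambda>y. bv (m, ns[j := (y, l)])) (act ?N s x)
        - bv (m, ns[j := (x, map (\<lambda>a. l ! s a) [0..<ar ?N x])])"
    and j: "j < length ns" by blast
  have cell: "cell_wt n (c, map (\<lambda>(x, l). (x, map s l)) qs) = (cell_wt n (c, qs) :: 'k)" for n c qs
    by (simp add: cell_wt_def case_prod_beta)
  show "form L_wt v = 0"
  proof (cases x)
    case (Inl a)
    then show ?thesis by (simp add: v dsum_def map_update)
  next
    case (Inr cq)
    obtain c qs where cq: "cq = (c, qs)" by (cases cq)
    show ?thesis
    proof (cases "map fst ns" rule: length_le_2_cases)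
      case (2 a)
      with j have "j = 0" by (cases ns) auto
      with 2 show ?thesis by (simp add: v Inr cq dsum_def map_update cell)
    next
      case (3 a b)
      with j have "length ns = 2" by (metis length_map length_Cons list.size(3) numeral_2_eq_2)
      with j have "j = 0 \<or> j = 1" by auto
      with 3 show ?thesis by (cases a; cases b) (auto simp: v Inr cq dsum_def map_update cell)
    next
      case 4
      then show ?thesis by (simp add: v Inr cq dsum_def map_update slots_wt_long)
    qed (use j in simp)
  qed
next
  let ?P = "Perm :: (nat \<times> nat, 'k) operad"
  let ?N = "dsum unit_dgs (compos (Bar ?P) ?P)"
  fix v
  assume "v \<in> {lin (\<lambda>m'. bv (m', ns)) (act ?P s m)
        - scl (perm_sgn (map (\<lambda>(x, l). deg ?N x) ns) s) (bv (m, map (\<lambda>i. ns ! s i) [0..<ar ?P m])) |m ns s.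
      (m, ns) \<in> compos_gens ?P ?N \<and> s permutes {..<ar ?P m}}"
  then obtain m ns s where v: "v = lin (\<lambda>m'. bv (m', ns)) (act ?P s m)
        - scl (perm_sgn (map (\<lambda>(x, l). deg ?N x) ns) s) (bv (m, map (\<lambda>i. ns ! s i) [0..<ar ?P m]))"
    and g: "(m, ns) \<in> compos_gens ?P ?N" and s: "s permutes {..<ar ?P m}" by blast
  have len: "ar ?P m = length ns" using compos_gens_D[OF g] by simp
  let ?sg = "perm_sgn (map (\<lambda>(x, l). deg ?N x) ns) s :: 'k"
  have "form L_wt v = slots_wt (map fst ns) - ?sg * slots_wt (map (\<lambda>i. fst (ns ! s i)) [0..<length ns])"
    by (cases m) (use len in \<open>simp add: v o_def\<close>)
  also have "\<dots> = 0"
  proof (cases ns rule: length_le_2_cases)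
    case (2 a)
    with s len have "s = id" by (auto simp: lessThan_Suc)
    moreover have "?sg = 1" by (rule perm_sgn_zero) (use 2 s len in auto)
    ultimately show ?thesis using 2 by simp
  next
    case (3 a b)
    have s2: "s permutes {..<2}" using s len 3 by (simp add: numeral_2_eq_2)
    have sg: "?sg = 1" if "isl (fst a) \<or> isl (fst b)"
    proof (rule perm_sgn_zero)
      fix i k assume "i < length (map (\<lambda>(x, l). deg ?N x) ns)" "k < length (map (\<lambda>(x, l). deg ?N x) ns)" "i \<noteq> k"
      then have "(i = 0 \<and> k = 1) \<or> (i = 1 \<and> k = 0)" using 3 by (auto simp: less_Suc_eq)
      then show "map (\<lambda>(x, l). deg ?N x) ns ! i * map (\<lambda>(x, l). deg ?N x) ns ! k = 0"
        using that 3 by (cases "fst a"; cases "fst b") (auto simp: case_prod_beta)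
    qed (use s2 3 in \<open>simp add: numeral_2_eq_2\<close>)
    have "slots_wt (map (\<lambda>i. fst (ns ! s i)) [0..<length ns]) = (slots_wt (map fst ns) :: 'k)"
      using s2
    proof (cases rule: permutes_2_cases)
      case 1
      then show ?thesis using 3 by simp
    next
      case 2
      then show ?thesis using 3 by (cases "fst a"; cases "fst b") simp_all
    qed
    then show ?thesis using sg 3 by (cases "fst a"; cases "fst b") auto
  next
    case 4
    then show ?thesis by (simp add: slots_wt_long)
  qed simp
  finally show "form L_wt v = 0" .
qed auto

abbreviation "L_Perm \<equiv> L_mod Perm (Bar Perm) (bar_pi Perm)"

lemma L_mod_simps:
  "gens (L_mod P C \<alpha>) = {(m, ns) \<in> compos_gens P (dsum unit_dgs (compos C P)). length (filter (\<lambda>(x, l). \<not> isl x) ns) = 1}"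
  "ar (L_mod P C \<alpha>) = (\<lambda>(m, ns). length (concat (map snd ns)))"
  "deg (L_mod P C \<alpha>) = (\<lambda>(m, ns). deg P m + (\<Sum>(x, l)\<leftarrow>ns. deg (dsum unit_dgs (compos C P)) x))"
  "rels (L_mod P C \<alpha>) = {r \<in> compos_rels P (dsum unit_dgs (compos C P)). Poly_Mapping.keys r \<subseteq> gens (L_mod P C \<alpha>)}"
  "act (L_mod P C \<alpha>) = (\<lambda>s (m, ns). bv (m, map (\<lambda>(x, l). (x, map s l)) ns))"
  by (simp_all add: L_mod_def compos1_def compos_lin_def Let_def compos_def)

text \<open>
  What a list of operations of \<open>Perm\<close> on the inputs makes of one input of the root: a leaf that carries an
  operation of arity \<open>n\<close> becomes \<open>n\<close> leaves, since this operation is composed with the root, and a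
  cell has its upper factors composed.  Labels are dropped, as the weight ignores them.
\<close>

definition act_on_slot :: "(nat \<times> nat) list \<Rightarrow> (unit + 'c \<times> ((nat \<times> nat) \<times> nat list) list) \<times> nat list \<Rightarrow>
    (unit + 'c \<times> ((nat \<times> nat) \<times> nat list) list) list"
  where "act_on_slot rs = (\<lambda>(s, l). case s of
      Inl _ \<Rightarrow> replicate (fst (rs ! (l ! 0))) (Inl ())
    | Inr (c, qs) \<Rightarrow> [Inr (c, map (\<lambda>(q, l'). let es = map (\<lambda>i. rs ! (l ! i)) l' in
        ((\<Sum>e\<leftarrow>es. fst e, (\<Sum>e\<leftarrow>take (snd q) es. fst e) + snd (es ! snd q)),
          concat (map (block fst (map ((!) rs) l)) l'))) qs)])"

text \<open>
  Since the composite of basis elements of \<open>Perm\<close> is a basis element, so is the result of the right action.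
\<close>

lemma ract_slots:
  fixes slots :: "((unit + 'c \<times> ((nat \<times> nat) \<times> nat list) list) \<times> nat list) list"
  assumes "\<And>c qs l q l' i. (Inr (c, qs), l) \<in> set slots \<Longrightarrow> (q, l') \<in> set qs \<Longrightarrow> i \<in> set l' \<Longrightarrow> i < length l"
  shows "\<exists>p' slots'. ract_compos1 Perm (ract_compos Perm) (p, slots) rs = (bv (p', slots') :: _ \<Rightarrow>\<^sub>0 'k::field)
    \<and> map fst slots' = concat (map (act_on_slot rs) slots)"
proof -
  define ff :: "(unit + 'c \<times> ((nat \<times> nat) \<times> nat list) list) \<times> nat list \<Rightarrow>
      (nat \<times> nat) \<times> ((unit + 'c \<times> ((nat \<times> nat) \<times> nat list) list) \<times> nat list) list"
    where "ff = (\<lambda>(s, l). case s of Inl _ \<Rightarrow> (rs ! (l ! 0), leaves_of (block fst rs (l ! 0)))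
    | Inr (c, qs) \<Rightarrow> ((1, 0), [(hd (act_on_slot rs (s, l)), concat (map (block fst rs) l))]))"
  have slot: "(case x of (s, l) \<Rightarrow> (case s of
        Inl _ \<Rightarrow> bv (rs ! (l ! 0), leaves_of (block fst rs (l ! 0)))
      | Inr x \<Rightarrow> lin (\<lambda>y. bv (one Perm, [(Inr y, concat (map (block fst rs) l))]))
          (ract_compos Perm x (map ((!) rs) l)))) = (bv (ff x) :: _ \<Rightarrow>\<^sub>0 'k)" if "x \<in> set slots" for x
  proof -
    obtain s l where x: "x = (s, l)" by (cases x)
    show ?thesis
    proof (cases s)
      case (Inr y)
      obtain c qs where y: "y = (c, qs)" by (cases y)
      have idx: "i < length l" if "(q, l') \<in> set qs" "i \<in> set l'" for q l' i
        using assms \<open>x \<in> set slots\<close> that unfolding x Inr y by blast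
      have nth: "map ((!) (map ((!) rs) l)) l' = map (\<lambda>i. rs ! (l ! i)) l'" if "(q, l') \<in> set qs" for q l'
        using idx that by auto
      have nth': "map (fst \<circ> (!) (map ((!) rs) l)) l' = map (fst \<circ> (\<lambda>i. rs ! (l ! i))) l'" if "(q, l') \<in> set qs" for q l'
        using idx that by auto
      have "tens (map (\<lambda>(q, l'). lin (\<lambda>y. bv (y, concat (map (block fst (map ((!) rs) l)) l')))
          (gam Perm q (map ((!) (map ((!) rs) l)) l'))) qs)
        = (tens (map (\<lambda>z. bv ((\<lambda>(q, l'). let es = map (\<lambda>i. rs ! (l ! i)) l' in
        ((\<Sum>e\<leftarrow>es. fst e, (\<Sum>e\<leftarrow>take (snd q) es. fst e) + snd (es ! snd q)),
          concat (map (block fst (map ((!) rs) l)) l'))) z)) qs) :: _ \<Rightarrow>\<^sub>0 'k)"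
        by (intro arg_cong[of _ _ tens] map_cong refl) (auto simp: nth nth' Let_def case_prod_beta)
      then show ?thesis
        by (simp add: x Inr y ff_def ract_compos_def act_on_slot_def)
    qed (simp add: x ff_def)
  qed
  have 1: "tens (map (\<lambda>(s, l). case s of
        Inl _ \<Rightarrow> bv (rs ! (l ! 0), leaves_of (block fst rs (l ! 0)))
      | Inr x \<Rightarrow> lin (\<lambda>y. bv (one Perm, [(Inr y, concat (map (block fst rs) l))]))
          (ract_compos Perm x (map ((!) rs) l))) slots) = (bv (map ff slots) :: _ \<Rightarrow>\<^sub>0 'k)"
    unfolding tens_bv[symmetric] by (intro arg_cong[of _ _ tens] map_cong refl slot)
  have 2: "map fst (snd (ff x)) = act_on_slot rs x" for x
    by (auto simp: ff_def act_on_slot_def leaves_of_def block_def Let_def map_replicate_const o_def split: sum.splits prod.splits)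
  have "ract_compos1 Perm (ract_compos Perm) (p, slots) rs = (lin (graft Perm p) (bv (map ff slots)) :: _ \<Rightarrow>\<^sub>0 'k)"
    unfolding ract_compos1_def prod.case Perm_simps(2) by (simp only: 1)
  then show ?thesis
    by (cases p) (simp add: graft_def map_concat o_def 2)
qed

lemma sum_arities_eq_1:
  assumes "\<And>i. i \<in> set l' \<Longrightarrow> 1 \<le> fst (f i)"
  shows "(\<Sum>i\<leftarrow>l'. fst (f i)) = (1::nat) \<longleftrightarrow> length l' = 1 \<and> (\<forall>i\<in>set l'. fst (f i) = 1)"
proof (cases l' rule: length_le_2_cases)
  case (3 x y)
  with assms[of x] assms[of y] show ?thesis by auto
next
  case 4
  have "length xs \<le> (\<Sum>i\<leftarrow>xs. fst (f i))" if "set xs \<subseteq> set l'" for xs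
    using that by (induction xs) (use assms in force)+
  from this[of l'] 4 show ?thesis by auto
qed auto

text \<open>
  Arities are at least 1, so a composite has arity 1 only if all its parts have.
\<close>

lemma act_on_slot_Inr:
  fixes c :: "'x tree"
  assumes len: "\<And>q l'. (q, l') \<in> set qs \<Longrightarrow> length l' = fst q"
    and lab: "set (concat (map snd qs)) = {..<length l}"
    and pos: "\<And>i. i \<in> set l \<Longrightarrow> 1 \<le> fst (rs ! i)"
  obtains qs' where "act_on_slot rs (Inr (c, qs), l) = [Inr (c, qs')]"
    "\<And>n. cell_wt n (c, qs') = of_bool (\<forall>i\<in>set l. fst (rs ! i) = 1) * (cell_wt n (c, qs) :: 'k::field)"
proof -
  obtain qs' where qs': "act_on_slot rs (Inr (c, qs), l) = [Inr (c, qs')]"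
    and ar': "map (fst \<circ> fst) qs' = map (\<lambda>(q, l'). \<Sum>i\<leftarrow>l'. fst (rs ! (l ! i))) qs"
    by (simp add: act_on_slot_def Let_def case_prod_beta o_def)
  have 1: "(\<Sum>i\<leftarrow>l'. fst (rs ! (l ! i))) = 1 \<longleftrightarrow> fst q = 1 \<and> (\<forall>i\<in>set l'. fst (rs ! (l ! i)) = 1)"
    if "(q, l') \<in> set qs" for q l'
  proof -
    have "1 \<le> fst (rs ! (l ! i))" if "i \<in> set l'" for i
    proof -
      have "i \<in> {..<length l}" unfolding lab[symmetric] using that \<open>(q, l') \<in> set qs\<close> by force
      then show ?thesis by (intro pos) simp
    qed
    then show ?thesis using sum_arities_eq_1[of l' "\<lambda>i. rs ! (l ! i)"] len[OF that] by simp
  qed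
  have "(\<forall>q\<in>set qs'. fst (fst q) = 1) \<longleftrightarrow> (\<forall>a\<in>set (map (fst \<circ> fst) qs'). a = 1)" by simp
  also have "\<dots> \<longleftrightarrow> (\<forall>(q, l')\<in>set qs. (\<Sum>i\<leftarrow>l'. fst (rs ! (l ! i))) = 1)"
    unfolding ar' by auto
  also have "\<dots> \<longleftrightarrow> (\<forall>(q, l')\<in>set qs. fst q = 1 \<and> (\<forall>i\<in>set l'. fst (rs ! (l ! i)) = 1))"
    using 1 by (intro ball_cong) auto
  also have "\<dots> \<longleftrightarrow> (\<forall>q\<in>set qs. fst (fst q) = 1) \<and> (\<forall>i\<in>set (concat (map snd qs)). fst (rs ! (l ! i)) = 1)"
    by fastforce
  also have "(\<forall>i\<in>set (concat (map snd qs)). fst (rs ! (l ! i)) = 1) \<longleftrightarrow> (\<forall>i\<in>set l. fst (rs ! i) = 1)"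
    unfolding lab by (auto simp: all_set_conv_all_nth)
  finally have "cell_wt n (c, qs') = of_bool (\<forall>i\<in>set l. fst (rs ! i) = 1) * (cell_wt n (c, qs) :: 'k)" for n
    unfolding cell_wt_def prod.case by (simp add: of_bool_conj mult_ac)
  with qs' show thesis using that by blast
qed

lemma act_on_slot_nonempty:
  assumes "\<And>i. i \<in> set (snd x) \<Longrightarrow> 1 \<le> fst (rs ! i)" "snd x \<noteq> []"
  shows "1 \<le> length (act_on_slot rs x)"
proof -
  obtain a l where "snd x = a # l" using assms(2) by (cases "snd x") auto
  with assms(1) show ?thesis by (auto simp: act_on_slot_def split: sum.splits prod.splits)
qed

lemma slots_wt_leaves [simp]: "slots_wt (replicate n (Inl u)) = 0"
  by (cases n; cases "n - 1"; cases "n - 2") auto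

text \<open>
  The reason why the weight factors over \<open>Lbar\<close>: a non-trivial operation on a leaf of a binary root
  produces a root of arity at least 3, and one above the cell produces a non-trivial upper factor.  Both
  have weight 0.
\<close>

lemma slots_wt_act:
  fixes slots :: "((unit + 'x tree \<times> ((nat \<times> nat) \<times> nat list) list) \<times> nat list) list"
  assumes ne: "\<And>x. x \<in> set slots \<Longrightarrow> snd x \<noteq> []"
    and leaf: "\<And>l. (Inl (), l) \<in> set slots \<Longrightarrow> length l = 1"
    and len: "\<And>c qs l q l'. (Inr (c, qs), l) \<in> set slots \<Longrightarrow> (q, l') \<in> set qs \<Longrightarrow> length l' = fst q"
    and lab: "\<And>c qs l. (Inr (c, qs), l) \<in> set slots \<Longrightarrow> set (concat (map snd qs)) = {..<length l}"
    and pos: "\<And>i. i \<in> set (concat (map snd slots)) \<Longrightarrow> 1 \<le> fst (rs ! i)"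
  shows "slots_wt (concat (map (act_on_slot rs) slots)) =
    of_bool (\<forall>i\<in>set (concat (map snd slots)). fst (rs ! i) = 1) * (slots_wt (map fst slots) :: 'k::field)"
proof -
  let ?w = "slots_wt (concat (map (act_on_slot rs) slots)) :: 'k"
  have leaf_slot: "\<exists>n. act_on_slot rs (Inl () :: unit + 'x tree \<times> _, l) = replicate (Suc n) (Inl ()) \<and> (n = 0 \<longleftrightarrow> (\<forall>i\<in>set l. fst (rs ! i) = 1))"
    if "(Inl (), l) \<in> set slots" for l
  proof -
    from leaf[OF that] obtain a where l: "l = [a]" by (auto simp: length_Suc_conv)
    have "1 \<le> fst (rs ! a)" using that l by (intro pos) force
    then obtain n where "fst (rs ! a) = Suc n" by (cases "fst (rs ! a)") auto
    then show ?thesis by (intro exI[of _ n]) (simp add: act_on_slot_def l)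
  qed
  have cell_slot: "\<exists>qs'. act_on_slot rs (Inr (c, qs), l) = [Inr (c, qs')] \<and>
      (\<forall>n. cell_wt n (c, qs') = of_bool (\<forall>i\<in>set l. fst (rs ! i) = 1) * (cell_wt n (c, qs) :: 'k))"
    if "(Inr (c, qs), l) \<in> set slots" for c qs l
  proof -
    have "1 \<le> fst (rs ! i)" if "i \<in> set l" for i
      using that \<open>(Inr (c, qs), l) \<in> set slots\<close> by (intro pos) force
    then show ?thesis
      using act_on_slot_Inr[of qs l rs c thesis] len[OF that] lab[OF that] by (metis (no_types, lifting) act_on_slot_Inr)
  qed
  show ?thesis
  proof (cases slots rule: length_le_2_cases)
    case (2 x)
    obtain s l where x: "x = (s, l)" by (cases x)
    show ?thesis
    proof (cases s)
      case (Inl a)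
      with leaf_slot[of l] 2 x obtain n where n: "act_on_slot rs (Inl () :: unit + 'x tree \<times> _, l) = replicate (Suc n) (Inl ())" by auto
      then show ?thesis using 2 x Inl by (simp del: replicate_Suc add: n)
    next
      case (Inr y)
      obtain c qs where y: "y = (c, qs)" by (cases y)
      from cell_slot[of c qs l] 2 x Inr y show ?thesis by auto
    qed
  next
    case (3 x y)
    obtain s l where x: "x = (s, l)" by (cases x)
    obtain t k where y: "y = (t, k)" by (cases y)
    show ?thesis
    proof (cases s)
      case (Inl u)
      with leaf_slot[of l] 3 x obtain n where
        n: "act_on_slot rs (Inl () :: unit + 'x tree \<times> _, l) = replicate (Suc n) (Inl ())" "n = 0 \<longleftrightarrow> (\<forall>i\<in>set l. fst (rs ! i) = 1)" by auto
      show ?thesis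
      proof (cases t)
        case (Inl u')
        with leaf_slot[of k] 3 y obtain m where m: "act_on_slot rs (Inl () :: unit + 'x tree \<times> _, k) = replicate (Suc m) (Inl ())" by auto
        have "concat (map (act_on_slot rs) slots) = replicate (Suc n + Suc m) (Inl ())"
          using 3 x y Inl \<open>s = Inl u\<close> n m by (simp add: replicate_add replicate_append_same)
        then show ?thesis using 3 x y Inl \<open>s = Inl u\<close> by (simp only: slots_wt_leaves) simp
      next
        case (Inr cq)
        obtain c qs where cq: "cq = (c, qs)" by (cases cq)
        from cell_slot[of c qs k] 3 y Inr cq obtain qs' where
          qs': "act_on_slot rs (Inr (c, qs), k) = [Inr (c, qs')]"
          "cell_wt 2 (c, qs') = of_bool (\<forall>i\<in>set k. fst (rs ! i) = 1) * (cell_wt 2 (c, qs) :: 'k)" by auto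
        have w: "?w = slots_wt (replicate (Suc n) (Inl ()) @ [Inr (c, qs')])"
          using 3 x y Inr \<open>s = Inl u\<close> n qs' cq by simp
        show ?thesis
        proof (cases "n = 0")
          case True
          with w have "?w = cell_wt 2 (c, qs')" by simp
          with True show ?thesis using 3 x y Inr \<open>s = Inl u\<close> n qs' cq by (simp add: ball_Un)
        next
          case False
          then have "?w = 0" unfolding w by (intro slots_wt_long) auto
          with False show ?thesis using 3 x y n by auto
        qed
      qed
    next
      case (Inr cq)
      obtain c qs where cq: "cq = (c, qs)" by (cases cq)
      from cell_slot[of c qs l] 3 x Inr cq obtain qs' where
        qs': "act_on_slot rs (Inr (c, qs), l) = [Inr (c, qs')]"
        "cell_wt 2 (c, qs') = of_bool (\<forall>i\<in>set l. fst (rs ! i) = 1) * (cell_wt 2 (c, qs) :: 'k)" by auto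
      show ?thesis
      proof (cases t)
        case (Inl u')
        with leaf_slot[of k] 3 y obtain n where
          n: "act_on_slot rs (Inl () :: unit + 'x tree \<times> _, k) = replicate (Suc n) (Inl ())" "n = 0 \<longleftrightarrow> (\<forall>i\<in>set k. fst (rs ! i) = 1)" by auto
        have w: "?w = slots_wt ([Inr (c, qs')] @ replicate (Suc n) (Inl ()))"
          using 3 x y Inr \<open>t = Inl u'\<close> n qs' cq by simp
        show ?thesis
        proof (cases "n = 0")
          case True
          with w have "?w = cell_wt 2 (c, qs')" by simp
          with True show ?thesis using 3 x y Inr \<open>t = Inl u'\<close> n qs' cq by (simp add: ball_Un)
        next
          case False
          then have "?w = 0" unfolding w by (intro slots_wt_long) auto
          with False show ?thesis using 3 x y n by auto
        qed
      next
        case (Inr dq)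
        obtain d ds where dq: "dq = (d, ds)" by (cases dq)
        from cell_slot[of d ds k] 3 y Inr dq obtain ds' where
          "act_on_slot rs (Inr (d, ds), k) = [Inr (d, ds')]" by auto
        then show ?thesis using 3 x y Inr \<open>s = Inr cq\<close> qs' cq dq by simp
      qed
    qed
  next
    case 4
    have "length slots \<le> length (concat (map (act_on_slot rs) slots))"
    proof -
      have "length xs \<le> length (concat (map (act_on_slot rs) xs))" if "set xs \<subseteq> set slots" for xs
        using that
      proof (induction xs)
        case (Cons x xs)
        have "1 \<le> length (act_on_slot rs x)"
          using Cons.prems by (intro act_on_slot_nonempty pos ne) force+
        with Cons show ?case by simp
      qed simp
      then show ?thesis by blast
    qed
    with 4 show ?thesis by (simp add: slots_wt_long)
  qed simp
qed

lemma tvalid_Perm_leaves: "tvalid Perm t \<Longrightarrow> tleaves t \<noteq> []"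
proof (induction t)
  case (Vtx p ts)
  then obtain t where "t \<in> set ts" by (cases ts) auto
  with Vtx show ?case by (auto simp: list_all_iff)
qed simp

lemma L_slots:
  fixes p :: "nat \<times> nat"
  assumes "(p, slots) \<in> gens (L_Perm :: (_, 'k::field) dgs)"
  shows "length slots = fst p" "snd p < fst p" "\<And>x. x \<in> set slots \<Longrightarrow> snd x \<noteq> []"
    "\<And>l. (Inl (), l) \<in> set slots \<Longrightarrow> length l = 1"
    "\<And>c qs l. (Inr (c, qs), l) \<in> set slots \<Longrightarrow>
      (c, qs) \<in> compos_gens (Bar Perm :: (_, 'k) cooperad) (Perm :: (_, 'k) operad)"
    "\<And>c qs l q l'. (Inr (c, qs), l) \<in> set slots \<Longrightarrow> (q, l') \<in> set qs \<Longrightarrow> length l' = fst q \<and> snd q < fst q"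
    "\<And>c qs l. (Inr (c, qs), l) \<in> set slots \<Longrightarrow> set (concat (map snd qs)) = {..<length l}"
    "set (concat (map snd slots)) = {..<length (concat (map snd slots))}"
    "length (filter (\<lambda>(x, l). \<not> isl x) slots) = 1"
proof -
  let ?P = "Perm :: (nat \<times> nat, 'k) operad"
  have g: "(p, slots) \<in> compos_gens ?P (dsum unit_dgs (compos (Bar ?P) ?P))"
    and one: "length (filter (\<lambda>(x, l). \<not> isl x) slots) = 1"
    using assms unfolding L_mod_simps by blast+
  note D = compos_gens_D[OF g]
  show "length slots = fst p" "snd p < fst p" using D(1,2) by auto
  show leaf: "length l = 1" if "(Inl (), l) \<in> set slots" for l using D(4)[OF that] by simp
  show cell: "(c, qs) \<in> compos_gens (Bar ?P) ?P" if "(Inr (c, qs), l) \<in> set slots" for c qs l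
    using D(3)[OF that] by auto
  show q: "length l' = fst q \<and> snd q < fst q" if "(Inr (c, qs), l) \<in> set slots" "(q, l') \<in> set qs" for c qs l q l'
    using compos_gens_D(3,4)[OF cell[OF that(1)] that(2)] by auto
  have len: "length l = length (concat (map snd qs))" if "(Inr (c, qs), l) \<in> set slots" for c qs l
    using D(4)[OF that] by simp
  show "set (concat (map snd qs)) = {..<length l}" if "(Inr (c, qs), l) \<in> set slots" for c qs l
    using compos_gens_D(6)[OF cell[OF that]] len[OF that] by metis
  show "snd x \<noteq> []" if "x \<in> set slots" for x
  proof (cases "fst x")
    case (Inl u)
    with that have "(Inl (), snd x) \<in> set slots" by (metis old.unit.exhaust surjective_pairing)
    from leaf[OF this] show ?thesis by auto
  next
    case (Inr cq)
    obtain c qs where cq: "cq = (c, qs)" by (cases cq)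
    have x: "(Inr (c, qs), snd x) \<in> set slots" using that Inr cq by (metis prod.collapse)
    have "tvalid ?P c" using compos_gens_D(1)[OF cell[OF x]] by (simp add: tree_gens_def)
    then have "tleaves c \<noteq> []" by (rule tvalid_Perm_leaves)
    then have "qs \<noteq> []" using compos_gens_D(2)[OF cell[OF x]] by auto
    then obtain q l' qs0 where "qs = (q, l') # qs0" by (cases qs) auto
    then show ?thesis using q[OF x, of q l'] len[OF x] by auto
  qed
  show "set (concat (map snd slots)) = {..<length (concat (map snd slots))}" by (rule D(6))
  show "length (filter (\<lambda>(x, l). \<not> isl x) slots) = 1" by (rule one)
qed

text \<open>
  The two sides of the relation that defines the relative composition product have the same weight: it is
  the weight of \<open>m\<close> if all operations \<open>rs\<close> are the identity, and 0 otherwise.  On the first side this is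
  the augmentation, on the second it is the previous analysis of the right action.
\<close>

lemma base_change_wt:
  fixes m xs
  defines "rs \<equiv> map (\<lambda>((r, ns), l). r) xs"
  assumes "(m, xs) \<in> compos_gens (L_Perm :: (_, 'k::field) dgs) (compos Perm unit_dgs)"
  shows "form (\<lambda>(m, us). L_wt m) (lin (\<lambda>es. bv (m, es))
        (tens (map (\<lambda>((r, ns), l). lin (\<lambda>y. bv (y, concat (map snd (unfold_labels ns l))))
          (unit_lact (Perm :: (_, 'k) operad) r (map fst ns))) xs))) = (of_bool (\<forall>r\<in>set rs. fst r = 1) * L_wt m :: 'k)"
    and "form L_wt (ract_compos1 Perm (ract_compos Perm) m rs) = (of_bool (\<forall>r\<in>set rs. fst r = 1) * L_wt m :: 'k)"
proof -
  note D = compos_gens_D[OF assms(2)]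
  obtain p slots where m: "m = (p, slots)" by (cases m)
  note S = L_slots[OF D(1)[unfolded m]]
  have len: "length xs = length (concat (map snd slots))" using D(2) by (simp add: L_mod_simps m)
  have "snd r < fst r" if "((r, ns), l) \<in> set xs" for r ns l
    using D(3)[OF that] compos_gens_D(1)[of r ns "Perm :: (_, 'k) operad" unit_dgs] by auto
  then have r: "snd r < fst r" if "r \<in> set rs" for r
    using that by (auto simp: rs_def)
  have "length rs = length xs" by (simp add: rs_def)
  obtain p' slots' where ract: "ract_compos1 Perm (ract_compos Perm) m rs = (bv (p', slots') :: _ \<Rightarrow>\<^sub>0 'k)"
    and slots': "map fst slots' = concat (map (act_on_slot rs) slots)"
    unfolding m using ract_slots[of slots p rs] S(7) by fastforce
  have all: "(\<forall>i\<in>set (concat (map snd slots)). fst (rs ! i) = 1) \<longleftrightarrow> (\<forall>r\<in>set rs. fst r = 1)"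
    unfolding S(8) len[symmetric] by (auto simp: all_set_conv_all_nth \<open>length rs = length xs\<close>)
  have "slots_wt (concat (map (act_on_slot rs) slots)) =
      (of_bool (\<forall>i\<in>set (concat (map snd slots)). fst (rs ! i) = 1) * slots_wt (map fst slots) :: 'k)"
  proof (rule slots_wt_act)
    show "1 \<le> fst (rs ! i)" if "i \<in> set (concat (map snd slots))" for i
      using that r[of "rs ! i"] \<open>length rs = length xs\<close> unfolding S(8) len[symmetric] by force
  qed (use S(3,4,6,7) in blast)+
  then show "form L_wt (ract_compos1 Perm (ract_compos Perm) m rs) =
      (of_bool (\<forall>r\<in>set rs. fst r = 1) * L_wt m :: 'k)"
    unfolding ract all by (simp add: slots' m)
  let ?vs = "map (\<lambda>((r, ns), l). lin (\<lambda>y. bv (y, concat (map snd (unfold_labels ns l))))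
          (unit_lact (Perm :: (_, 'k) operad) r (map fst ns))) xs"
  show "form (\<lambda>(m, us). L_wt m) (lin (\<lambda>es. bv (m, es)) (tens ?vs)) = (of_bool (\<forall>r\<in>set rs. fst r = 1) * L_wt m :: 'k)"
  proof (cases "\<forall>r\<in>set rs. fst r = 1")
    case True
    then have "fst (fst (fst x)) = 1 \<and> snd (fst (fst x)) = 0" if "x \<in> set xs" for x
      using r[of "fst (fst x)"] that by (force simp: rs_def case_prod_beta)
    then have "fst (fst x) = (1, 0)" if "x \<in> set xs" for x
      using that by (simp add: prod_eq_iff)
    \<comment> \<open>Operations of arity 1 are the identity, on which the augmentation is 1.\<close>
    then have vs: "?vs = map (\<lambda>x. bv ((), concat (map snd (unfold_labels (snd (fst x)) (snd x))))) xs"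
      by (intro map_cong refl) (auto simp: unit_lact_def aug_def case_prod_beta)
    show ?thesis unfolding vs tens_bv using True by simp
  next
    case False
    then obtain x where x: "x \<in> set xs" "fst (fst (fst x)) \<noteq> 1" by (auto simp: rs_def)
    have "0 = (\<lambda>((r, ns), l). lin (\<lambda>y. bv (y, concat (map snd (unfold_labels ns l))))
          (unit_lact (Perm :: (_, 'k) operad) r (map fst ns))) x"
      using x(2) by (auto simp: unit_lact_def aug_def case_prod_beta)
    then have "0 \<in> set ?vs" unfolding set_map using x(1) by (rule image_eqI)
    then have "tens ?vs = 0" by (rule tens_zero)
    then show ?thesis using False by simp
  qed
qed

abbreviation "Lbar_Perm \<equiv> Lbar_mod Perm (Bar Perm) (bar_pi Perm)"

lemma rels_update: "rels (M\<lparr>rels := X\<rparr>) = X"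
  by simp

lemma Lbar_rels:
  "rels (Lbar_mod P C \<alpha>) = vec.span (compos_rels (L_mod P C \<alpha>) unit_dgs \<union>
    {lin (\<lambda>es. bv (m, es))
        (tens (map (\<lambda>((r, ns), l). lin (\<lambda>y. bv (y, concat (map snd (unfold_labels ns l))))
          (unit_lact P r (map fst ns))) xs))
      - lin (\<lambda>m'. bv (m', concat (map (\<lambda>((r, ns), l). unfold_labels ns l) xs)))
          (ract_compos1 P (ract_compos P) m (map (\<lambda>((r, ns), l). r) xs)) |m xs.
      (m, xs) \<in> compos_gens (L_mod P C \<alpha>) (compos P unit_dgs)})"
  unfolding Lbar_mod_def rel_compos_def rels_update compos_simps(1) ..

lemma L_rels_unit_wt:
  assumes "r \<in> compos_rels L_Perm unit_dgs"
  shows "form (\<lambda>(m, us). L_wt m) r = (0 :: 'k::field)"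
  using assms unfolding compos_rels_def
proof (rule form_span, elim UnE)
  let ?L = "L_Perm :: (_, 'k) dgs"
  let ?U = "unit_dgs :: (_, 'k) dgs"
  fix v
  assume "v \<in> {lin (\<lambda>m. bv (m, ns)) r |r ns.
      r \<in> rels ?L \<and> (\<forall>m\<in>Poly_Mapping.keys r. (m, ns) \<in> compos_gens ?L ?U)}"
  then obtain r ns where v: "v = lin (\<lambda>m. bv (m, ns)) r" and r: "r \<in> rels ?L" by blast
  have "form L_wt r = (0 :: 'k)" using r by (intro slots_rels_wt) (simp add: L_mod_simps)
  then show "form (\<lambda>(m, us). L_wt m) v = 0" by (simp add: v)
next
  let ?L = "L_Perm :: (_, 'k) dgs"
  let ?U = "unit_dgs :: (_, 'k) dgs"
  fix v
  assume "v \<in> {lin (\<lambda>m'. bv (m', ns)) (act ?L s m)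
        - scl (perm_sgn (map (\<lambda>(x, l). deg ?U x) ns) s) (bv (m, map (\<lambda>i. ns ! s i) [0..<ar ?L m])) |m ns s.
      (m, ns) \<in> compos_gens ?L ?U \<and> s permutes {..<ar ?L m}}"
  then obtain m ns s where v: "v = lin (\<lambda>m'. bv (m', ns)) (act ?L s m)
        - scl (perm_sgn (map (\<lambda>(x, l). deg ?U x) ns) s) (bv (m, map (\<lambda>i. ns ! s i) [0..<ar ?L m]))"
    and g: "(m, ns) \<in> compos_gens ?L ?U" and s: "s permutes {..<ar ?L m}" by blast
  have "perm_sgn (map (\<lambda>(x, l). deg ?U x) ns) s = (1 :: 'k)"
    using s compos_gens_D(2)[OF g] by (intro perm_sgn_zero) (auto simp: case_prod_beta)
  then show "form (\<lambda>(m, us). L_wt m) v = 0"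
    by (cases m) (simp add: v L_mod_simps case_prod_beta o_def)
qed auto

lemma Lbar_rels_wt:
  assumes "r \<in> rels Lbar_Perm"
  shows "form (\<lambda>(m, us). L_wt m) r = (0 :: 'k::field)"
  using assms unfolding Lbar_rels
proof (rule form_span, elim UnE)
  fix v :: "_ \<Rightarrow>\<^sub>0 'k"
  assume "v \<in> {lin (\<lambda>es. bv (m, es))
        (tens (map (\<lambda>((r, ns), l). lin (\<lambda>y. bv (y, concat (map snd (unfold_labels ns l))))
          (unit_lact Perm r (map fst ns))) xs))
      - lin (\<lambda>m'. bv (m', concat (map (\<lambda>((r, ns), l). unfold_labels ns l) xs)))
          (ract_compos1 Perm (ract_compos Perm) m (map (\<lambda>((r, ns), l). r) xs)) |m xs.
      (m, xs) \<in> compos_gens (L_Perm :: (_, 'k) dgs) (compos Perm unit_dgs)}"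
  then obtain m xs where v: "v = lin (\<lambda>es. bv (m, es))
        (tens (map (\<lambda>((r, ns), l). lin (\<lambda>y. bv (y, concat (map snd (unfold_labels ns l))))
          (unit_lact Perm r (map fst ns))) xs))
      - lin (\<lambda>m'. bv (m', concat (map (\<lambda>((r, ns), l). unfold_labels ns l) xs)))
          (ract_compos1 Perm (ract_compos Perm) m (map (\<lambda>((r, ns), l). r) xs))"
    and g: "(m, xs) \<in> compos_gens (L_Perm :: (_, 'k) dgs) (compos Perm unit_dgs)" by blast
  have "form (\<lambda>(m, us). L_wt m) v = form (\<lambda>(m, us). L_wt m) (lin (\<lambda>es. bv (m, es))
        (tens (map (\<lambda>((r, ns), l). lin (\<lambda>y. bv (y, concat (map snd (unfold_labels ns l))))
          (unit_lact Perm r (map fst ns))) xs)))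
      - (form L_wt (ract_compos1 Perm (ract_compos Perm) m (map (\<lambda>((r, ns), l). r) xs)) :: 'k)"
    unfolding v form_diff form_lin[of _ _ "ract_compos1 _ _ _ _"] form_bv prod.case ..
  also have "\<dots> = 0"
    unfolding base_change_wt[OF g] by simp
  finally show "form (\<lambda>(m, us). L_wt m) v = 0" .
qed (use L_rels_unit_wt in blast)

section \<open>The weight of a boundary\<close>

lemma join_cuts_2:
  "join_cuts p [d0, d1] = scl (ksgn ((\<Sum>(u, l)\<leftarrow>snd d0. tdeg u) * tdeg (fst d1)))
     (bv (Vtx p [trelabel ((!) [0..<length (snd d0)]) (fst d0),
       trelabel ((!) [length (snd d0)..<length (snd d0) + length (snd d1)]) (fst d1)], snd d0 @ snd d1))"
proof -
  have "{(i, j). i < j \<and> j < length [d0, d1]} = {(0, 1)}" by (auto simp: less_Suc_eq)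
  then show ?thesis by (simp add: join_cuts_def block_def Let_def case_prod_beta upt_rec[of 0 2] numeral_2_eq_2)
qed

lemma ksgn_0 [simp]: "ksgn 0 = 1" by (simp add: ksgn_def)

text \<open>
  The infinitesimal decompositions of the trees that matter.  The counit leaves the trivial cuts, where one
  of the two parts is a bare leaf, and, for two vertices, the cut of the inner edge.
\<close>

lemma pcop_2:
  assumes "a \<noteq> b"
  shows "pcop (Bar P) (Vtx p [Leaf a, Leaf b]) = (
    bv (Leaf 0, [(Inr (Vtx p [Leaf 0, Leaf 1]), [a, b])])
    + bv (Vtx p [Leaf 0, Leaf 1], [(Inr (Leaf 0), [a]), (Inl (), [b])])
    + bv (Vtx p [Leaf 0, Leaf 1], [(Inl (), [a]), (Inr (Leaf 0), [b])]) :: _ \<Rightarrow>\<^sub>0 'k::field)"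
  using assms by (simp add: pcop_def join_cuts_2 tstd_def Let_def lessThan_Suc insert_Diff_if numeral_2_eq_2 add_ac)

lemma pcop_left:
  assumes "a \<noteq> b" "a \<noteq> d" "b \<noteq> d"
  shows "pcop (Bar P) (Vtx p [Vtx q [Leaf a, Leaf b], Leaf d]) = (
    bv (Leaf 0, [(Inr (Vtx p [Vtx q [Leaf 0, Leaf 1], Leaf 2]), [a, b, d])])
    + bv (Vtx p [Leaf 0, Leaf 1], [(Inr (Vtx q [Leaf 0, Leaf 1]), [a, b]), (Inl (), [d])])
    + bv (Vtx p [Vtx q [Leaf 0, Leaf 1], Leaf 2], [(Inr (Leaf 0), [a]), (Inl (), [b]), (Inl (), [d])])
    + bv (Vtx p [Vtx q [Leaf 0, Leaf 1], Leaf 2], [(Inl (), [a]), (Inr (Leaf 0), [b]), (Inl (), [d])])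
    + bv (Vtx p [Vtx q [Leaf 0, Leaf 1], Leaf 2], [(Inl (), [a]), (Inl (), [b]), (Inr (Leaf 0), [d])])
    :: _ \<Rightarrow>\<^sub>0 'k::field)"
  using assms by (simp add: pcop_def join_cuts_2 tstd_def Let_def lessThan_Suc insert_Diff_if numeral_2_eq_2 add_ac)

lemma pcop_right:
  assumes "a \<noteq> b" "a \<noteq> d" "b \<noteq> d"
  shows "pcop (Bar P) (Vtx p [Leaf d, Vtx q [Leaf a, Leaf b]]) = (
    bv (Leaf 0, [(Inr (Vtx p [Leaf 0, Vtx q [Leaf 1, Leaf 2]]), [d, a, b])])
    + bv (Vtx p [Leaf 0, Leaf 1], [(Inl (), [d]), (Inr (Vtx q [Leaf 0, Leaf 1]), [a, b])])
    + bv (Vtx p [Leaf 0, Vtx q [Leaf 1, Leaf 2]], [(Inr (Leaf 0), [d]), (Inl (), [a]), (Inl (), [b])])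
    + bv (Vtx p [Leaf 0, Vtx q [Leaf 1, Leaf 2]], [(Inl (), [d]), (Inr (Leaf 0), [a]), (Inl (), [b])])
    + bv (Vtx p [Leaf 0, Vtx q [Leaf 1, Leaf 2]], [(Inl (), [d]), (Inl (), [a]), (Inr (Leaf 0), [b])])
    :: _ \<Rightarrow>\<^sub>0 'k::field)"
  using assms by (simp add: pcop_def join_cuts_2 tstd_def Let_def lessThan_Suc insert_Diff_if numeral_2_eq_2 add_ac)

lemma tdeg_eq_0_iff: "tdeg t = 0 \<longleftrightarrow> (\<exists>a. t = Leaf a)"
proof (cases t)
  case (Vtx p ts)
  have "0 \<le> sum_list (map tdeg ts)" by simp
  then have "tdeg t \<noteq> 0" unfolding Vtx tdeg.simps by linarith
  then show ?thesis by (auto simp: Vtx)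
qed simp

text \<open>
  Every vertex has at least two children.
\<close>

lemma tleaves_ge_tdeg:
  assumes "tvalid (Perm :: (nat \<times> nat, 'k::field) operad) t"
  shows "tdeg t + 1 \<le> int (length (tleaves t))"
  using assms
proof (induction t)
  case (Vtx p ts)
  have "2 \<le> length ts" using Vtx.prems by (cases p) auto
  have "(\<Sum>t\<leftarrow>us. tdeg t + 1) \<le> (\<Sum>t\<leftarrow>us. int (length (tleaves t)))" if "set us \<subseteq> set ts" for us
    using that by (induction us) (use Vtx in \<open>force simp: list_all_iff\<close>)+
  from this[of ts] have "sum_list (map tdeg ts) + int (length ts) \<le> (\<Sum>t\<leftarrow>ts. int (length (tleaves t)))"
    by (simp add: sum_list_addf sum_list_triv)
  with \<open>2 \<le> length ts\<close> show ?case by (simp add: length_concat int_sum_list_map o_def)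
qed simp

lemma binary_tree_cases:
  assumes "tvalid (Perm :: (nat \<times> nat, 'k::field) operad) t" "tdeg t = 2" "length (tleaves t) \<le> 3"
  obtains i j a b d where "t = Vtx (2, i) [Vtx (2, j) [Leaf a, Leaf b], Leaf d]"
    | i j a b d where "t = Vtx (2, i) [Leaf d, Vtx (2, j) [Leaf a, Leaf b]]"
proof -
  note thesis1 = that(1) and thesis2 = that(2)
  let ?P = "Perm :: (nat \<times> nat, 'k) operad"
  obtain k i ts where t: "t = Vtx (k, i) ts" using assms(2) by (cases t) auto
  have k: "2 \<le> k" "length ts = k" and valid: "\<And>u. u \<in> set ts \<Longrightarrow> tvalid ?P u"
    using assms(1) unfolding t by (auto simp: list_all_iff)
  have leaves: "tdeg u + 1 \<le> int (length (tleaves u))" if "u \<in> set ts" for u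
    using tleaves_ge_tdeg[OF valid[OF that]] .
  have cor: "\<exists>j a b. u = Vtx (2, j) [Leaf a, Leaf b]"
    if "u \<in> set ts" and deg_u: "tdeg u = 1" and len_u: "length (tleaves u) \<le> 2" for u
  proof -
    obtain k' j us where u: "u = Vtx (k', j) us" using deg_u by (cases u) auto
    have "tvalid ?P u" using valid \<open>u \<in> set ts\<close> by blast
    then have k': "2 \<le> k'" "length us = k'" and "\<And>w. w \<in> set us \<Longrightarrow> tvalid ?P w"
      unfolding u by (auto simp: list_all_iff)
    have us0: "sum_list (map tdeg us) = 0" using deg_u u by simp
    have "tdeg w = 0" if "w \<in> set us" for w
    proof -
      have "0 \<le> sum_list (map tdeg (remove1 w us))" by simp
      then show ?thesis using sum_list_map_remove1[OF that, of tdeg] us0 tdeg_nonneg[of w] by linarith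
    qed
    then have lf: "\<exists>a. w = Leaf a" if "w \<in> set us" for w using that by (simp add: tdeg_eq_0_iff)
    show ?thesis
    proof (cases us rule: length_le_2_cases)
      case (3 x y)
      with lf[of x] lf[of y] k' u show ?thesis by auto
    next
      case 4
      then obtain x y z zs where "us = x # y # z # zs"
        by (auto simp: Suc_le_length_iff numeral_3_eq_3)
      with lf[of x] lf[of y] lf[of z] len_u u show ?thesis by auto
    qed (use k' in auto)
  qed
  have sum: "sum_list (map tdeg ts) = 1" using assms(2) t by simp
  have len: "(\<Sum>u\<leftarrow>ts. length (tleaves u)) \<le> 3" using assms(3) t by (simp add: length_concat o_def)
  show thesis
  proof (cases ts rule: length_le_2_cases)
    case (3 x y)
    have s: "tdeg x + tdeg y = 1" using sum 3 by simp
    have l: "int (length (tleaves x)) + int (length (tleaves y)) \<le> 3" using len 3 by simp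
    have lx: "tdeg x + 1 \<le> int (length (tleaves x))" and ly: "tdeg y + 1 \<le> int (length (tleaves y))"
      using leaves 3 by auto
    have k2: "k = 2" using k 3 by simp
    consider "tdeg x = 0" "tdeg y = 1" | "tdeg y = 0" "tdeg x = 1"
      using s tdeg_nonneg[of x] tdeg_nonneg[of y] by linarith
    then show thesis
    proof cases
      case 1
      then have "length (tleaves y) \<le> 2" using l lx by linarith
      with cor[of y] 1 3 obtain j a b where "y = Vtx (2, j) [Leaf a, Leaf b]" by auto
      moreover obtain d where "x = Leaf d" using 1 tdeg_eq_0_iff by auto
      ultimately show thesis using thesis2 t 3 k2 by blast
    next
      case 2
      then have "length (tleaves x) \<le> 2" using l ly by linarith
      with cor[of x] 2 3 obtain j a b where "x = Vtx (2, j) [Leaf a, Leaf b]" by auto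
      moreover obtain d where "y = Leaf d" using 2 tdeg_eq_0_iff by auto
      ultimately show thesis using thesis1 t 3 k2 by blast
    qed
  next
    case 4
    have "(\<Sum>u\<leftarrow>us. tdeg u + 1) \<le> (\<Sum>u\<leftarrow>us. int (length (tleaves u)))" if "set us \<subseteq> set ts" for us
      using that by (induction us) (use leaves in force)+
    from this[of ts] have "1 + int (length ts) \<le> int (\<Sum>u\<leftarrow>ts. length (tleaves u))"
      using sum by (simp add: sum_list_addf sum_list_triv int_sum_list_map)
    with len 4 show thesis by linarith
  qed (use k in auto)
qed

lemma cell_wt_consec:
  "cell_wt n (c, consec f xs) = of_bool (\<forall>x\<in>set xs. fst x = 1) * tree_wt 1 n c"
proof -
  have "map fst (consec f xs) = xs" by (simp add: consec_def o_def map_nth)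
  then have "set xs = fst ` set (consec f xs)" by (metis set_map)
  then show ?thesis by (simp add: cell_wt_def)
qed

lemma bd_L_mod:
  "bd (L_mod P C \<alpha>) (p, slots) = bd (compos P (dsum unit_dgs (compos C P))) (p, slots)
    - L_left P C \<alpha> (p, slots) + L_right P C \<alpha> (p, slots)"
  by (simp add: L_mod_def compos1_def compos_lin_def Let_def)

lemma bar_pi_corolla [simp]:
  "bar_pi Perm (Vtx (2, i) [Leaf a, Leaf b]) = bv (2, if i < 2 then [a, b] ! i else i)"
  by (simp add: bar_pi_def)

lemma bar_pi_zero [simp]: "tdeg t \<noteq> 1 \<Longrightarrow> bar_pi P t = 0"
  by (auto simp: bar_pi_def split: tree.splits)

text \<open>
  The three parts of the differential on a generator of degree 2.  Only the cut of the inner edge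
  contributes to \<open>L_left\<close>, because \<open>\<pi>\<close> vanishes on a leaf and on a tree with two vertices; it turns the
  lower vertex into a binary root under a binary corolla.  In \<open>L_right\<close> the upper vertex becomes an upper
  factor of arity 2, which has weight 0.  The last part is the contraction of the inner edge into a
  corolla with 3 leaves; the child that is contracted follows at most a leaf, so there is no sign.
\<close>

lemma bd_binary_tree:
  assumes distinct: "a \<noteq> b" "a \<noteq> d" "b \<noteq> d"
    and Q: "fst (unfold_labels qs l ! a) = (1, 0)" "fst (unfold_labels qs l ! b) = (1, 0)"
      "fst (unfold_labels qs l ! d) = (1, 0)" "snd (unfold_labels qs l ! d) = [x]"
    and qs: "\<forall>q\<in>set qs. fst (fst q) = 1"
    and c: "c = Vtx (2, i) [Vtx (2, j) [Leaf a, Leaf b], Leaf d] \<or>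
      c = Vtx (2, i) [Leaf d, Vtx (2, j) [Leaf a, Leaf b]]"
  shows "form L_wt (L_left Perm (Bar Perm) (bar_pi Perm) ((1, 0), [(Inr (c, qs), l)])) = (1 :: 'k::field)"
    and "form L_wt (L_right Perm (Bar Perm) (bar_pi Perm) ((1, 0), [(Inr (c, qs), l)])) = (0 :: 'k)"
    and "form L_wt (bd (compos Perm (dsum unit_dgs (compos (Bar Perm) Perm))) ((1, 0), [(Inr (c, qs), l)])) = (1 :: 'k)"
  using c Q
  by (auto simp: L_left_def L_right_def pcop_left[OF distinct] pcop_right[OF distinct] fold_labels_def
      graft_def graft_at_def leaves_of_def cell_wt_consec tree_wt_def Let_def)
    (use qs in \<open>auto simp: compos_def dsum_def cell_wt_def tree_wt_def\<close>)

lemma Lbar_simps: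
  "gens (Lbar_mod P C \<alpha>) = compos_gens (L_mod P C \<alpha>) unit_dgs"
  "ar (Lbar_mod P C \<alpha>) = (\<lambda>(m, ns). length (concat (map snd ns)))"
  "deg (Lbar_mod P C \<alpha>) = (\<lambda>(m, ns). deg (L_mod P C \<alpha>) m)"
  "bd (Lbar_mod P C \<alpha>) = (\<lambda>(m, ns). lin (\<lambda>m'. bv (m', ns)) (bd (L_mod P C \<alpha>) m))"
  by (auto simp: Lbar_mod_def rel_compos_def compos_def case_prod_unfold)

lemma length_concat_ge:
  assumes "\<And>x. x \<in> set xs \<Longrightarrow> 1 \<le> length (f x)"
  shows "length xs \<le> length (concat (map f xs))"
  using assms by (induction xs) force+

text \<open>
  Counting leaves: a cell of degree 2 has at least 3 leaves, and these already exhaust the arity, which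
  leaves no room for further leaves of the root or for upper factors of arity at least 2.
\<close>

lemma Lbar_2_generators:
  assumes "(m, us) \<in> gens (Lbar_Perm :: (_, 'k::field) dgs)"
    "ar (Lbar_Perm :: (_, 'k::field) dgs) (m, us) = 3" "deg (Lbar_Perm :: (_, 'k::field) dgs) (m, us) = 2"
  obtains c qs l where "m = ((1, 0), [(Inr (c, qs), l)])" "tdeg c = 2" "length (tleaves c) = 3"
    "(c, qs) \<in> compos_gens (Bar Perm :: (_, 'k) cooperad) (Perm :: (_, 'k) operad)"
    "\<forall>q\<in>set qs. fst (fst q) = 1" "length l = 3"
proof -
  let ?L = "L_Perm :: (_, 'k) dgs"
  obtain p slots where m: "m = (p, slots)" by (cases m)
  have g: "((p, slots), us) \<in> compos_gens ?L (unit_dgs :: (_, 'k) dgs)"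
    using assms(1) by (simp add: Lbar_simps m)
  have gL: "(p, slots) \<in> gens ?L" using compos_gens_D(1)[OF g] .
  note S = L_slots[OF gL]
  have "length l = 1" if "(x, l) \<in> set us" for x l
    using compos_gens_D(4)[OF g that] by simp
  then have "map (length \<circ> snd) us = map (\<lambda>_. 1) us" by (intro map_cong refl) auto
  then have "length (concat (map snd us)) = length us" by (simp only: length_concat map_map sum_list_triv) simp
  then have "length us = 3" using assms(2) by (simp add: Lbar_simps)
  then have labels: "length (concat (map snd slots)) = 3"
    using compos_gens_D(2)[OF g] by (simp add: L_mod_simps)
  \<comment> \<open>\<open>y\<close> is the input that carries the cell.\<close>
  obtain y where "filter (\<lambda>x. \<not> isl (fst x)) slots = [y]"
    using S(9) by (auto simp: length_Suc_conv case_prod_unfold)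
  from filter_eq_ConsD[OF this] obtain ys zs where slots: "slots = ys @ y # zs" and y: "\<not> isl (fst y)"
    and ys: "\<forall>x\<in>set ys. isl (fst x)" and "[] = filter (\<lambda>x. \<not> isl (fst x)) zs" by auto
  then have leaves: "\<forall>x\<in>set ys \<union> set zs. isl (fst x)"
    using filter_empty_conv[of "\<lambda>x. \<not> isl (fst x)" zs] by auto
  obtain c qs l where cq: "y = (Inr (c, qs), l)" using y by (cases y; cases "fst y") auto
  let ?d = "\<lambda>x. deg (dsum unit_dgs (compos (Bar (Perm :: (_, 'k) operad)) Perm) :: (_, 'k) dgs) (fst x)"
  have d0: "map ?d ys = map (\<lambda>_. 0) ys" "map ?d zs = map (\<lambda>_. 0) zs"
    using leaves by (intro map_cong refl; force simp: isl_def)+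
  have "deg ?L (p, slots) = (\<Sum>x\<leftarrow>slots. ?d x)"
    by (simp only: L_mod_simps prod.case Perm_simps case_prod_unfold add_0 fst_conv snd_conv)
  also have "\<dots> = ?d y"
    unfolding slots map_append list.map sum_list_append sum_list.Cons d0 by simp
  also have "\<dots> = tdeg c"
    by (simp add: cq case_prod_unfold)
  finally have "deg ?L (p, slots) = tdeg c" .
  then have degc: "tdeg c = 2" using assms(3) by (simp add: Lbar_simps m)
  have inr: "(Inr (c, qs), l) \<in> set slots" by (simp add: slots cq)
  note gc = S(5)[OF inr]
  have valid: "tvalid (Perm :: (_, 'k) operad) c" using compos_gens_D(1)[OF gc] by (simp add: tree_gens_def)
  from tleaves_ge_tdeg[OF valid] degc have c3: "3 \<le> length (tleaves c)" by simp
  have lenqs: "length qs = length (tleaves c)" using compos_gens_D(2)[OF gc] by simp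
  have q: "length (snd q) = fst (fst q)" "1 \<le> fst (fst q)" if "q \<in> set qs" for q
    using S(6)[OF inr, of "fst q" "snd q"] that by auto
  have lenl: "length l = length (concat (map snd qs))"
    using compos_gens_D(4)[of p slots "Perm :: (_, 'k) operad" "dsum unit_dgs (compos (Bar Perm) Perm)", OF _ inr] gL
    by (simp add: L_mod_simps)
  have "length qs \<le> length l" unfolding lenl using q by (intro length_concat_ge) simp
  moreover have "length ys \<le> length (concat (map snd ys))" "length zs \<le> length (concat (map snd zs))"
    using S(3) slots by (intro length_concat_ge; force simp: Suc_le_eq)+
  moreover have "length (concat (map snd ys)) + (length l + length (concat (map snd zs))) = 3"
    using labels by (simp add: slots cq)
  ultimately have "length ys = 0 \<and> length zs = 0 \<and> length l = 3 \<and> length (tleaves c) = 3"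
    using c3 lenqs by linarith
  then have "ys = []" "zs = []" and l3: "length l = 3" and t3: "length (tleaves c) = 3"
    by auto
  then have slots1: "slots = [(Inr (c, qs), l)]" by (simp add: slots cq)
  then have "p = (1, 0)" using S(1,2) by (cases p) auto
  moreover have "\<forall>q\<in>set qs. fst (fst q) = 1"
  proof
    fix x assume x: "x \<in> set qs"
    then obtain xs1 xs2 where qs: "qs = xs1 @ x # xs2" by (meson split_list)
    have "length xs1 \<le> length (concat (map snd xs1))" "length xs2 \<le> length (concat (map snd xs2))"
      using q qs by (intro length_concat_ge; force)+
    then have "length (snd x) \<le> 1" using lenl l3 lenqs t3 unfolding qs by simp
    with q[OF x] show "fst (fst x) = 1" by simp
  qed
  ultimately show thesis using that[of c qs l] slots1 degc t3 gc l3 m by simp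
qed

text \<open>
  The contraction has weight 1, and so has the cut, which enters with the opposite sign.
\<close>

lemma Lbar_bd_wt:
  assumes "(m, us) \<in> gens (Lbar_Perm :: (_, 'k::field) dgs)"
    "ar (Lbar_Perm :: (_, 'k::field) dgs) (m, us) = 3" "deg (Lbar_Perm :: (_, 'k::field) dgs) (m, us) = 2"
  shows "form (\<lambda>(m, us). L_wt m) (bd Lbar_Perm (m, us)) = (0 :: 'k)"
  using assms
proof (rule Lbar_2_generators)
  fix c qs l
  assume m: "m = ((1, 0), [(Inr (c, qs), l)])" and c: "tdeg c = 2" "length (tleaves c) = 3"
    and g: "(c, qs) \<in> compos_gens (Bar Perm :: (_, 'k) cooperad) (Perm :: (_, 'k) operad)"
    and qs: "\<forall>q\<in>set qs. fst (fst q) = 1" and l: "length l = 3"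
  have t: "c \<in> tree_gens (Perm :: (_, 'k) operad)" using compos_gens_D(1)[OF g] by simp
  then have valid: "tvalid (Perm :: (_, 'k) operad) c" and dist: "distinct (tleaves c)"
    and lab: "set (tleaves c) = {..<3}" by (auto simp: tree_gens_def c)
  have lenqs: "length qs = 3" using compos_gens_D(2)[OF g] c by simp
  have q: "length (snd x) = 1" "fst x = (1, 0)" if "x \<in> set qs" for x
    using compos_gens_D(3,4)[OF g, of "fst x" "snd x"] that qs by (auto simp: prod_eq_iff)
  obtain i j a b d where c': "c = Vtx (2, i) [Vtx (2, j) [Leaf a, Leaf b], Leaf d] \<or>
      c = Vtx (2, i) [Leaf d, Vtx (2, j) [Leaf a, Leaf b]]"
    using binary_tree_cases[OF valid c(1)] c(2) by (metis order_refl)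
  have distinct: "a \<noteq> b" "a \<noteq> d" "b \<noteq> d" using dist c' by auto
  have "{a, b, d} = set (tleaves c)" using c' by auto
  then have lt: "a < 3" "b < 3" "d < 3" using lab by auto
  have Q: "fst (unfold_labels qs l ! y) = (1, 0)" "length (snd (unfold_labels qs l ! y)) = 1" if "y < 3" for y
    using q[of "qs ! y"] that lenqs by (auto simp: unfold_labels_def case_prod_beta)
  obtain x where x: "snd (unfold_labels qs l ! d) = [x]"
    using Q(2)[OF lt(3)] by (auto simp: length_Suc_conv)
  note B = bd_binary_tree[OF distinct Q(1)[OF lt(1)] Q(1)[OF lt(2)] Q(1)[OF lt(3)] x qs c']
  show ?thesis
    unfolding Lbar_simps m prod.case form_lin form_bv bd_L_mod form_add form_diff B by simp
qed

section \<open>A cycle of weight 1\<close>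

lemma lin_uminus: "lin f (- v) = - lin f v"
  using lin_diff[of f 0 v] by simp

text \<open>
  A generator is null if it arises by the action of a list of operations that contains a non-trivial one.
\<close>

lemma Lbar_rels_base_change:
  assumes "(m, xs) \<in> compos_gens (L_mod P C \<alpha>) (compos P unit_dgs)"
    and "\<exists>x\<in>set xs. fst (fst x) \<noteq> one P"
    and "ract_compos1 P (ract_compos P) m (map (\<lambda>((r, ns), l). r) xs) = (bv m' :: _ \<Rightarrow>\<^sub>0 'k::field)"
    and "us = concat (map (\<lambda>((r, ns), l). unfold_labels ns l) xs)"
  shows "bv (m', us) \<in> rels (Lbar_mod P C \<alpha>)"
proof -
  let ?f = "\<lambda>((r, ns), l). lin (\<lambda>y. bv (y, concat (map snd (unfold_labels ns l))))
          (unit_lact P r (map fst ns)) :: _ \<Rightarrow>\<^sub>0 'k"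
  obtain x where x: "x \<in> set xs" "fst (fst x) \<noteq> one P" using assms(2) by blast
  have "0 = ?f x" using x(2) by (auto simp: unit_lact_def aug_def case_prod_beta)
  then have "0 \<in> set (map ?f xs)" unfolding set_map using x(1) by (rule image_eqI)
  then have "tens (map ?f xs) = 0" by (rule tens_zero)
  then have eq: "lin (\<lambda>es. bv (m, es)) (tens (map ?f xs))
      - lin (\<lambda>m'. bv (m', concat (map (\<lambda>((r, ns), l). unfold_labels ns l) xs)))
          (ract_compos1 P (ract_compos P) m (map (\<lambda>((r, ns), l). r) xs)) = - bv (m', us)"
    unfolding assms(3) assms(4) by simp
  have "- bv (m', us) \<in> rels (Lbar_mod P C \<alpha>)"
    unfolding Lbar_rels eq[symmetric] by (rule vec.span_base) (use assms(1) in blast)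
  then show ?thesis unfolding Lbar_rels using vec.span_neg by fastforce
qed

text \<open>
  The cell that is left over when the only vertex of a corolla has been cut off.
\<close>

abbreviation identity_cell :: "(nat \<times> nat) tree \<times> ((nat \<times> nat) \<times> nat list) list"
  where "identity_cell \<equiv> (Leaf 0, [((1, 0), [0])])"

abbreviation std_labels :: "(unit \<times> nat list) list"
  where "std_labels \<equiv> [((), [0]), ((), [1]), ((), [2])]"

text \<open>
  The generator whose homology class is non-zero: a binary corolla on the first input of a binary root.
\<close>

abbreviation witness_gen :: "(nat \<times> nat) \<times> ((unit + (nat \<times> nat) tree \<times> ((nat \<times> nat) \<times> nat list) list) \<times> nat list) list"
  where "witness_gen \<equiv> ((2, 0), [(Inr (Vtx (2, 0) [Leaf 0, Leaf 1], [((1, 0), [0]), ((1, 0), [1])]), [0, 1]), (Inl (), [2])])"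

lemma lessThan_numerals: "{..<Suc 0} = {0}" "{..<2} = {0, Suc 0}" "{..<Suc (Suc 0)} = {0, Suc 0}"
   "{..<3} = {0, Suc 0, 2}" "{..<Suc (Suc (Suc 0))} = {0, Suc 0, 2}"
  by (auto simp: less_Suc_eq numeral_2_eq_2 numeral_3_eq_3)

text \<open>
  A form of the generators of \<open>L\<close> that simplification can decide on explicit trees.
\<close>

lemma gens_L_Perm:
  "(p, slots) \<in> gens (L_Perm :: (_, 'k::field) dgs) \<longleftrightarrow>
    snd p < fst p \<and> length slots = fst p \<and>
    (\<forall>(x, l)\<in>set slots. case x of Inl _ \<Rightarrow> length l = 1 | Inr (c, qs) \<Rightarrow>
      length l = length (concat (map snd qs)) \<and>
      c \<in> tree_gens (Perm :: (_, 'k) operad) \<and> length qs = length (tleaves c) \<and>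
      (\<forall>(q, l')\<in>set qs. snd q < fst q \<and> length l' = fst q) \<and>
      (let w = concat (map snd qs) in distinct w \<and> set w = {..<length w})) \<and>
    (let w = concat (map snd slots) in distinct w \<and> set w = {..<length w}) \<and>
    length (filter (\<lambda>(x, l). \<not> isl x) slots) = 1"
proof -
  let ?P = "Perm :: (nat \<times> nat, 'k) operad"
  have "(x \<in> gens (dsum unit_dgs (compos (Bar ?P) ?P)) \<and> length l = ar (dsum unit_dgs (compos (Bar ?P) ?P)) x) =
    (case x of Inl _ \<Rightarrow> length l = 1 | Inr (c, qs) \<Rightarrow>
      length l = length (concat (map snd qs)) \<and>
      c \<in> tree_gens ?P \<and> length qs = length (tleaves c) \<and>
      (\<forall>(q, l')\<in>set qs. snd q < fst q \<and> length l' = fst q) \<and>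
      (let w = concat (map snd qs) in distinct w \<and> set w = {..<length w}))" for x and l :: "nat list"
  proof (cases x)
    case (Inr cq)
    then show ?thesis
      by (cases cq) (simp add: image_iff compos_gens_def Let_def case_prod_unfold conj_commute conj_left_commute)
  qed (simp add: image_iff)
  then show ?thesis
    unfolding L_mod_simps compos_gens_def mem_Collect_eq prod.case Perm_simps
    by (simp only: case_prod_unfold fst_conv snd_conv mem_Collect_eq) blast
qed

text \<open>
  Cutting the vertex off from below yields a root of arity 3, with the remaining trivial cell on either of
  the inputs of the old vertex.  Cutting it off from above turns it into an upper factor.
\<close>

lemma witness_bd:
  "bd L_Perm witness_gen =
    - (bv ((3, 0), [(Inr identity_cell, [0]), (Inl (), [1]), (Inl (), [2])])
       + bv ((3, 0), [(Inl (), [0]), (Inr identity_cell, [1]), (Inl (), [2])]))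
    + (bv ((2, 0), [(Inr (Leaf 0, [((2, 0), [0, 1])]), [0, 1]), (Inl (), [2])]) :: _ \<Rightarrow>\<^sub>0 'k::field)"
  unfolding bd_L_mod
  by (simp add: L_left_def L_right_def pcop_2 fold_labels_def unfold_labels_def graft_def graft_at_def
      leaves_of_def Let_def compos_def dsum_def consec_def block_def tens_zero lessThan_Suc bar_pi_corolla[unfolded numeral_2_eq_2]
      numeral_2_eq_2 numeral_3_eq_3)

text \<open>
  The three terms of this boundary are null.  Here the last two inputs of the root are fused: the generator
  arises from a binary root with an operation of arity 2 on its leaf.
\<close>

lemma null_outer:
  "bv (((3, 0), [(Inr identity_cell, [0]), (Inl (), [1]), (Inl (), [2])]), std_labels) \<in> rels (Lbar_Perm :: (_, 'k::field) dgs)"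
proof -
  let ?xs = "[(((1, 0), [((), [0])]), [0]), (((2, 0), [((), [0]), ((), [1])]), [1, 2])] ::
    (((nat \<times> nat) \<times> (unit \<times> nat list) list) \<times> nat list) list"
  let ?m = "((2, 0), [(Inr identity_cell, [0]), (Inl (), [1])])"
  have g: "(?m, ?xs) \<in> compos_gens (L_Perm :: (_, 'k) dgs) (compos Perm unit_dgs)"
    by (simp add: Lbar_simps compos_gens_def gens_L_Perm L_mod_simps(2) tree_gens_def lessThan_numerals insert_commute)
  have ract: "ract_compos1 Perm (ract_compos Perm) ?m (map (\<lambda>((r, ns), l). r) ?xs) =
    (bv ((3, 0), [(Inr identity_cell, [0]), (Inl (), [1]), (Inl (), [2])]) :: _ \<Rightarrow>\<^sub>0 'k)"
    by (simp add: ract_compos1_def ract_compos_def graft_def leaves_of_def block_def Let_def numeral_2_eq_2 numeral_3_eq_3)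
  show ?thesis
    by (rule Lbar_rels_base_change[OF g _ ract]) (simp_all add: unfold_labels_def)
qed

text \<open>
  The upper factor of arity 2 is the action of that operation on the inputs of a trivial cell.
\<close>

lemma null_upper:
  "bv (((2, 0), [(Inr (Leaf 0, [((2, 0), [0, 1])]), [0, 1]), (Inl (), [2])]), std_labels) \<in> rels (Lbar_Perm :: (_, 'k::field) dgs)"
proof -
  let ?xs = "[(((2, 0), [((), [0]), ((), [1])]), [0, 1]), (((1, 0), [((), [0])]), [2])] ::
    (((nat \<times> nat) \<times> (unit \<times> nat list) list) \<times> nat list) list"
  let ?m = "((2, 0), [(Inr identity_cell, [0]), (Inl (), [1])])"
  have g: "(?m, ?xs) \<in> compos_gens (L_Perm :: (_, 'k) dgs) (compos Perm unit_dgs)"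
    by (simp add: Lbar_simps compos_gens_def gens_L_Perm L_mod_simps(2) tree_gens_def lessThan_numerals insert_commute)
  have ract: "ract_compos1 Perm (ract_compos Perm) ?m (map (\<lambda>((r, ns), l). r) ?xs) =
    (bv ((2, 0), [(Inr (Leaf 0, [((2, 0), [0, 1])]), [0, 1]), (Inl (), [2])]) :: _ \<Rightarrow>\<^sub>0 'k)"
    by (simp add: ract_compos1_def ract_compos_def graft_def leaves_of_def block_def Let_def numeral_2_eq_2 numeral_3_eq_3)
  show ?thesis
    by (rule Lbar_rels_base_change[OF g _ ract]) (simp_all add: unfold_labels_def)
qed

text \<open>
  In the remaining term the two leaves of the root are not adjacent.  This is the generator with the cell
  moved to the first input; \<open>null_middle\<close> reduces to it by the equivariance of the composition products,
  used once to move the cell and once to renumber the leaves.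
\<close>

lemma null_middle_std:
  "bv (((3, 1), [(Inr identity_cell, [0]), (Inl (), [1]), (Inl (), [2])]), [((), [1]), ((), [0]), ((), [2])])
    \<in> rels (Lbar_Perm :: (_, 'k::field) dgs)"
proof -
  let ?xs = "[(((1, 0), [((), [0])]), [1]), (((2, 0), [((), [0]), ((), [1])]), [0, 2])] ::
    (((nat \<times> nat) \<times> (unit \<times> nat list) list) \<times> nat list) list"
  let ?m = "((2, 1), [(Inr identity_cell, [0]), (Inl (), [1])])"
  have g: "(?m, ?xs) \<in> compos_gens (L_Perm :: (_, 'k) dgs) (compos Perm unit_dgs)"
    by (simp add: Lbar_simps compos_gens_def gens_L_Perm L_mod_simps(2) tree_gens_def lessThan_numerals insert_commute)
  have ract: "ract_compos1 Perm (ract_compos Perm) ?m (map (\<lambda>((r, ns), l). r) ?xs) =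
    (bv ((3, 1), [(Inr identity_cell, [0]), (Inl (), [1]), (Inl (), [2])]) :: _ \<Rightarrow>\<^sub>0 'k)"
    by (simp add: ract_compos1_def ract_compos_def graft_def leaves_of_def block_def Let_def numeral_2_eq_2 numeral_3_eq_3)
  show ?thesis
    by (rule Lbar_rels_base_change[OF g _ ract]) (simp_all add: unfold_labels_def)
qed

lemma compos_rels_root:
  assumes "r \<in> rels M" "\<forall>m\<in>Poly_Mapping.keys r. (m, ns) \<in> compos_gens M N"
  shows "lin (\<lambda>m. bv (m, ns)) r \<in> compos_rels M N"
  unfolding compos_rels_def by (rule vec.span_base) (use assms in blast)

text \<open>
  The relation between moving the factors above a root and acting on the root has no sign if these factors
  have degree 0.
\<close>

lemma compos_rels_act:
  assumes "(m, ns) \<in> compos_gens M N" "s permutes {..<ar M m}" "\<And>i. i < length ns \<Longrightarrow> deg N (fst (ns ! i)) = 0"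
  shows "lin (\<lambda>m'. bv (m', ns)) (act M s m) - bv (m, map (\<lambda>i. ns ! s i) [0..<ar M m])
    \<in> (compos_rels M N :: (_ \<Rightarrow>\<^sub>0 'k::field) set)"
proof -
  have "perm_sgn (map (\<lambda>(x, l). deg N x) ns) s = (1 :: 'k)"
    using assms compos_gens_D(2)[OF assms(1)] by (intro perm_sgn_zero) (auto simp: case_prod_unfold)
  then have eq: "lin (\<lambda>m'. bv (m', ns)) (act M s m) - bv (m, map (\<lambda>i. ns ! s i) [0..<ar M m]) =
     lin (\<lambda>m'. bv (m', ns)) (act M s m) -
       scl (perm_sgn (map (\<lambda>(x, l). deg N x) ns) s) (bv (m, map (\<lambda>i. ns ! s i) [0..<ar M m]) :: _ \<Rightarrow>\<^sub>0 'k)"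
    by simp
  show ?thesis unfolding eq unfolding compos_rels_def
    by (rule vec.span_base) (use assms(1,2) in blast)
qed

lemma null_middle:
  "bv (((3, 0), [(Inl (), [0]), (Inr identity_cell, [1]), (Inl (), [2])]), std_labels)
    \<in> rels (Lbar_Perm :: (_, 'k::field) dgs)"
proof -
  let ?P = "Perm :: (nat \<times> nat, 'k) operad"
  let ?L = "L_Perm :: (_, 'k) dgs"
  let ?U = "unit_dgs :: (_, 'k) dgs"
  let ?N = "dsum unit_dgs (compos (Bar ?P) ?P)"
  let ?s = "transpose 0 (1 :: nat)"
  let ?X = "Inr identity_cell :: unit + (nat \<times> nat) tree \<times> ((nat \<times> nat) \<times> nat list) list"
  let ?ns = "[(Inl (), [0]), (?X, [1]), (Inl (), [2])] :: ((unit + (nat \<times> nat) tree \<times> ((nat \<times> nat) \<times> nat list) list) \<times> nat list) list"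
  let ?ns' = "[(?X, [1]), (Inl (), [0]), (Inl (), [2])] :: ((unit + (nat \<times> nat) tree \<times> ((nat \<times> nat) \<times> nat list) list) \<times> nat list) list"
  let ?ns'' = "[(?X, [0]), (Inl (), [1]), (Inl (), [2])] :: ((unit + (nat \<times> nat) tree \<times> ((nat \<times> nat) \<times> nat list) list) \<times> nat list) list"
  let ?us' = "[((), [1]), ((), [0]), ((), [2])]"
  have s: "?s permutes {..<3}" by (rule permutes_swap_id) auto
  have gens: "((3, 1), ?ns) \<in> gens ?L" "((3, 0), ?ns) \<in> gens ?L" "((3, 1), ?ns') \<in> gens ?L" "((3, 1), ?ns'') \<in> gens ?L"
    by (simp_all add: gens_L_Perm tree_gens_def lessThan_numerals insert_commute)
  have upt3: "[0..<3] = [0, 1, 2::nat]" by (simp add: numeral_3_eq_3 numeral_2_eq_2)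
  define r :: "((nat \<times> nat) \<times> ((unit + (nat \<times> nat) tree \<times> ((nat \<times> nat) \<times> nat list) list) \<times> nat list) list) \<Rightarrow>\<^sub>0 'k" where "r = bv ((3, 0), ?ns) - bv ((3, 1), ?ns')"
  have "((3, 1), ?ns) \<in> compos_gens ?P ?N" using gens(1) by (simp add: L_mod_simps)
  moreover have "deg ?N (fst (?ns ! i)) = 0" if "i < length ?ns" for i
    using that by (auto simp: less_Suc_eq)
  ultimately have "r \<in> compos_rels ?P ?N"
    using compos_rels_act[of "(3, 1)" ?ns ?P ?N ?s] s by (simp add: r_def upt3 transpose_def)
  moreover have keys_r: "Poly_Mapping.keys r \<subseteq> {((3, 0), ?ns), ((3, 1), ?ns')}"
    unfolding r_def by (rule order_trans[OF keys_diff]) (simp add: bv_def)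
  ultimately have r: "r \<in> rels ?L" using gens by (auto simp: L_mod_simps(4))
  have std: "(((i, j), slots), std_labels) \<in> compos_gens ?L ?U" if "((i, j), slots) \<in> gens ?L" "length (concat (map snd slots)) = 3" for i j slots
    using that by (simp add: compos_gens_def L_mod_simps(2) lessThan_numerals insert_commute)
  have 1: "lin (\<lambda>m. bv (m, std_labels)) r \<in> compos_rels ?L ?U"
  proof (rule compos_rels_root[OF r], intro ballI)
    fix m assume "m \<in> Poly_Mapping.keys r"
    with keys_r have "m = ((3, 0), ?ns) \<or> m = ((3, 1), ?ns')" by blast
    moreover have "(((3, 0), ?ns), std_labels) \<in> compos_gens ?L ?U" by (rule std[OF gens(2)]) simp
    moreover have "(((3, 1), ?ns'), std_labels) \<in> compos_gens ?L ?U" by (rule std[OF gens(3)]) simp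
    ultimately show "(m, std_labels) \<in> compos_gens ?L ?U" by metis
  qed
  have "(((3, 1), ?ns''), std_labels) \<in> compos_gens ?L ?U" using gens by (intro std) auto
  from compos_rels_act[OF this, of ?s] s[unfolded numeral_3_eq_3]
  have 2: "bv (((3, 1), ?ns'), std_labels) - bv (((3, 1), ?ns''), ?us') \<in> (compos_rels ?L ?U :: (_ \<Rightarrow>\<^sub>0 'k) set)"
    by (simp add: L_mod_simps(2,5) upt3 transpose_def)
  have "lin (\<lambda>m. bv (m, std_labels)) r \<in> rels (Lbar_Perm :: (_, 'k) dgs)"
    "bv (((3, 1), ?ns'), std_labels) - bv (((3, 1), ?ns''), ?us') \<in> rels (Lbar_Perm :: (_, 'k) dgs)"
    unfolding Lbar_rels using 1 2 by (auto intro: vec.span_base)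
  from vec.span_add[OF vec.span_add[OF this[unfolded Lbar_rels]] null_middle_std[unfolded Lbar_rels]]
  show ?thesis unfolding Lbar_rels by (simp add: r_def)
qed

section \<open>The homology class\<close>

lemma witness_wt: "L_wt witness_gen = (1 :: 'k::field)"
  by (simp add: cell_wt_def tree_wt_def)

lemma hcomp_bv: "bv x \<in> hcomp M n d \<longleftrightarrow> x \<in> gens M \<and> ar M x = n \<and> deg M x = d"
  by (simp add: hcomp_def bv_def)

lemma hcomp_add: "v \<in> hcomp M n d \<Longrightarrow> w \<in> hcomp M n d \<Longrightarrow> v + w \<in> hcomp M n d"
  using keys_add[of v w] by (auto simp: hcomp_def)

lemma hcomp_uminus: "v \<in> hcomp M n d \<Longrightarrow> - v \<in> hcomp M n d"
  by (simp add: hcomp_def keys_minus)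

lemma form_lin_eq_0:
  assumes "v \<in> hcomp M n d" "\<And>x. x \<in> gens M \<Longrightarrow> ar M x = n \<Longrightarrow> deg M x = d \<Longrightarrow> form f (g x) = 0"
  shows "form f (lin g v) = 0"
proof -
  have "form (\<lambda>x. form f (g x)) v = (\<Sum>x\<in>Poly_Mapping.keys v. Poly_Mapping.lookup v x * form f (g x))"
    by (simp add: form_def[of _ v])
  also have "\<dots> = 0"
    using assms by (intro sum.neutral) (auto simp: hcomp_def)
  finally show ?thesis by simp
qed

lemma O_Perm_simps:
  "elts (O_Perm :: (_, 'k::field_char_0) subquot) n d =
    {v \<in> hcomp Lbar_Perm n d. lin (Lbar_proj (Bar Perm)) v \<in> rels (Omegabar_mod Perm)}"
  "null (O_Perm :: (_, 'k) subquot) n d = hcomp Lbar_Perm n d \<inter> rels Lbar_Perm"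
  "dd (O_Perm :: (_, 'k) subquot) = lin (bd Lbar_Perm)"
  by (simp_all add: O_Perm_def obstruction_def kernel_def)

lemma zero_in_rels_Omegabar: "0 \<in> rels (Omegabar_mod P)"
  unfolding Omegabar_mod_def rel_compos_def rels_update by (rule vec.span_zero)

lemma witness_gens: "(witness_gen, std_labels) \<in> gens (Lbar_Perm :: (_, 'k::field) dgs)"
  by (simp add: Lbar_simps compos_gens_def gens_L_Perm L_mod_simps(2) tree_gens_def lessThan_numerals insert_commute)

text \<open>
  The generator lies in the kernel of the map to \<open>Omegabar\<close>, since the counit vanishes on its cell.
\<close>

lemma witness_cycle: "bv (witness_gen, std_labels) \<in> cycles (O_Perm :: (_, 'k::field_char_0) subquot) 1 3"
proof -
  let ?z = "bv (witness_gen, std_labels) :: _ \<Rightarrow>\<^sub>0 'k"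
  let ?a = "bv (((3, 0), [(Inr identity_cell, [0]), (Inl (), [1]), (Inl (), [2])]), std_labels) :: _ \<Rightarrow>\<^sub>0 'k"
  let ?b = "bv (((3, 0), [(Inl (), [0]), (Inr identity_cell, [1]), (Inl (), [2])]), std_labels) :: _ \<Rightarrow>\<^sub>0 'k"
  let ?c = "bv (((2, 0), [(Inr (Leaf 0, [((2, 0), [0, 1])]), [0, 1]), (Inl (), [2])]), std_labels) :: _ \<Rightarrow>\<^sub>0 'k"
  have "?z \<in> hcomp Lbar_Perm 3 1"
    unfolding hcomp_bv using witness_gens by (simp add: Lbar_simps L_mod_simps)
  moreover have "lin (Lbar_proj (Bar Perm)) ?z = 0"
    by (simp add: Lbar_proj_def L_proj_def)
  ultimately have "?z \<in> elts O_Perm 3 1"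
    by (simp add: O_Perm_simps zero_in_rels_Omegabar del: lin_bv)
  moreover have "dd O_Perm ?z \<in> null O_Perm 3 (1 - 1)"
  proof -
    have dz: "dd O_Perm ?z = - (?a + ?b) + ?c"
      unfolding O_Perm_simps lin_bv Lbar_simps prod.case witness_bd lin_add lin_uminus ..
    have "?a \<in> rels Lbar_Perm" "?b \<in> rels Lbar_Perm" "?c \<in> rels Lbar_Perm"
      by (rule null_outer null_middle null_upper)+
    then have "- (?a + ?b) + ?c \<in> rels Lbar_Perm"
      unfolding Lbar_rels by (intro vec.span_add vec.span_neg)
    moreover have "?a \<in> hcomp Lbar_Perm 3 0" "?b \<in> hcomp Lbar_Perm 3 0" "?c \<in> hcomp Lbar_Perm 3 0"
      unfolding hcomp_bv
      by (simp_all add: Lbar_simps compos_gens_def gens_L_Perm L_mod_simps(2,3) tree_gens_def lessThan_numerals insert_commute)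
    then have "- (?a + ?b) + ?c \<in> hcomp Lbar_Perm 3 0"
      by (intro hcomp_add hcomp_uminus)
    ultimately show ?thesis unfolding dz by (simp add: O_Perm_simps)
  qed
  ultimately show ?thesis by (simp add: cycles_def)
qed

text \<open>
  A boundary is the image of a combination of generators of arity 3 and degree 2, on each of which the
  weight of the differential vanishes, plus a relation.
\<close>

lemma boundaries_wt:
  assumes "v \<in> boundaries (O_Perm :: (_, 'k::field_char_0) subquot) 1 3"
  shows "form (\<lambda>(m, us). L_wt m) v = (0 :: 'k)"
proof -
  obtain y r where v: "v = lin (bd Lbar_Perm) y + r" and y: "y \<in> hcomp (Lbar_Perm :: (_, 'k) dgs) 3 2"
    and r: "r \<in> rels (Lbar_Perm :: (_, 'k) dgs)"
    using assms by (auto simp: boundaries_def O_Perm_simps)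
  have "form (\<lambda>(m, us). L_wt m) (lin (bd Lbar_Perm) y) = (0 :: 'k)"
    using y by (rule form_lin_eq_0) (use Lbar_bd_wt in fastforce)
  then show ?thesis using Lbar_rels_wt[OF r] by (simp add: v del: form_lin)
qed

text \<open>
  If the only homology class were that of 0, the cycle of weight 1 would be a boundary.
\<close>

theorem proposition6p2p1:
  shows "\<exists>n. homology (O_Perm :: (_, 'k::field_char_0) subquot) 1 n \<noteq> {boundaries O_Perm 1 n}"
proof (intro exI[of _ 3] notI)
  let ?X = "O_Perm :: (_, 'k) subquot"
  let ?z = "bv (witness_gen, std_labels) :: _ \<Rightarrow>\<^sub>0 'k"
  assume "homology ?X 1 3 = {boundaries O_Perm 1 3}"
  then have coset: "(+) ?z ` boundaries ?X 1 3 = boundaries ?X 1 3"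
    using witness_cycle by (auto simp: homology_def)
  have "0 \<in> elts ?X 3 (1 + 1)" "0 \<in> null ?X 3 1"
    by (simp_all add: O_Perm_simps hcomp_def zero_in_rels_Omegabar Lbar_rels vec.span_zero)
  moreover have "dd ?X 0 + 0 = 0" by (simp add: O_Perm_simps)
  ultimately have "0 \<in> boundaries ?X 1 3" unfolding boundaries_def by force
  then have "?z + 0 \<in> boundaries ?X 1 3" using coset by blast
  then have "form (\<lambda>(m, us). L_wt m) ?z = (0 :: 'k)" using boundaries_wt by fastforce
  then show False using witness_wt[where 'k = 'k] by simp
qed

end
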